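(* Let $(a_k)_{k\ge0}$ be a sequence of complex random variables (no independence or identical distribution is assumed). Assume that: (a) there exists some $s>0$ such that, with $\lambda_k:=\mathbb E[|a_k|^s]$, one has $\lambda_k<\infty$ for all $k$ and $\limsup_{k\to\infty}(\lambda_k)^{1/k}=1$; (b) there exists some $t>0$ such that for all $k$, $\xi_k:=\mathbb E\left[\frac{1}{|a_k|^t}\right]<\infty$, and $\limsup_{k\to\infty}(\xi_k)^{1/k}=1$. Let $P_N(Z)=\sum_{k=0}^N a_kZ^k$. Then there exists a deterministic positive sequence $(\alpha_N)$ with $0<\alpha_N\le N$ for all $N$ and $\alpha_N=o(N)$ as $N\to\infty$, such that $$\lim_{N\to\infty}\frac1N\nu_N\left(\frac{\alpha_N}{N}\right)=1\quad\text{almost surely}$$ and, for all $0\le\theta<\phi\le2\pi$, $$\lim_{N\to\infty}\frac1N\nu_N(\theta,\phi)=\frac{\phi-\theta}{2\pi}\quad\text{almost surely.}$$ In fact both convergences also hold in the $p$-th mean for every positive $p$.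
   Context: All random variables are defined on one probability space $(\Omega,\mathcal F,\mathbb P)$ with expectation $\mathbb E$; $1/|a_k|^t$ is read as $+\infty$ where $a_k=0$. For $N\ge1$ let $z_1,\dots,z_N$ be the complex zeros of $P_N$, counted with multiplicity (almost surely $a_0a_N\neq0$). For $0\le\rho\le1$, $\nu_N(\rho)=\#\{k:1-\rho\le|z_k|\le\frac1{1-\rho}\}$, with $\frac1{1-\rho}$ read as $+\infty$ when $\rho=1$. For $0\le\theta<\phi\le2\pi$, $\nu_N(\theta,\phi)=\#\{k:\theta\le\arg(z_k)<\phi\}$, where the argument takes values in $[0,2\pi)$. Convergence $X_N\to X$ in the $p$-th mean means $\mathbb E[|X_N-X|^p]\to0$. *)

theory Defs
  imports
    "HOL-Probability.Probability"
    "HOL-Computational_Algebra.Polynomial"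
    "HOL-Library.Landau_Symbols"
begin

definition abs_moment :: "'w measure \<Rightarrow> ('w \<Rightarrow> complex) \<Rightarrow> real \<Rightarrow> ennreal" where
  "abs_moment M X s = (\<integral>\<^sup>+ w. ennreal (norm (X w) powr s) \<partial>M)"

(* In ennreal, 1 / 0 = top, so the integrand is infinite where X vanishes. *)
definition inv_abs_moment :: "'w measure \<Rightarrow> ('w \<Rightarrow> complex) \<Rightarrow> real \<Rightarrow> ennreal" where
  "inv_abs_moment M X t = (\<integral>\<^sup>+ w. 1 / ennreal (norm (X w) powr t) \<partial>M)"

definition rand_poly :: "(nat \<Rightarrow> 'w \<Rightarrow> complex) \<Rightarrow> nat \<Rightarrow> 'w \<Rightarrow> complex poly" where
  "rand_poly a N w = (\<Sum>k\<le>N. monom (a k w) k)"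

(* proots counts zeros with multiplicity; proots 0 = {#}. *)
definition zeros_annulus :: "complex poly \<Rightarrow> real \<Rightarrow> nat" where
  "zeros_annulus P \<rho> =
     size {# z \<in># proots P. 1 - \<rho> \<le> norm z \<and> (\<rho> = 1 \<or> norm z \<le> 1 / (1 - \<rho>)) #}"

(* Arg2pi takes values in [0, 2*pi). *)
definition zeros_sector :: "complex poly \<Rightarrow> real \<Rightarrow> real \<Rightarrow> nat" where
  "zeros_sector P \<theta> \<phi> = size {# z \<in># proots P. \<theta> \<le> Arg2pi z \<and> Arg2pi z < \<phi> #}"

(* Measurability and integrability are explicit because the Bochner integral of a
   non-integrable function is 0 by convention. *)
definition converges_in_mean ::
    "'w measure \<Rightarrow> real \<Rightarrow> (nat \<Rightarrow> 'w \<Rightarrow> real) \<Rightarrow> ('w \<Rightarrow> real) \<Rightarrow> bool" where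
  "converges_in_mean M p X Y \<longleftrightarrow>
     Y \<in> borel_measurable M \<and>
     (\<forall>N. X N \<in> borel_measurable M \<and> integrable M (\<lambda>w. \<bar>X N w - Y w\<bar> powr p)) \<and>
     (\<lambda>N. \<integral>w. \<bar>X N w - Y w\<bar> powr p \<partial>M) \<longlonglongrightarrow> 0"

end

theory Submission
  imports
    Defs
    "HOL-Complex_Analysis.Complex_Analysis"
    "HOL-Computational_Algebra.Fundamental_Theorem_Algebra"
    "HOL-Library.Real_Mod"
    "HOL-Real_Asymp.Real_Asymp"
begin

text \<open>
  For a polynomial \<open>p = \<Sum> c\<^sub>k z\<^sup>k\<close> of degree \<open>n\<close> with \<open>c\<^sub>0 \<noteq> 0\<close>, put \<open>S = \<Sum> |c\<^sub>k|\<close> and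
  \<open>E(p) = ln (S\<^sup>2 / (|c\<^sub>0| |c\<^sub>n|))\<close> (\<open>root_energy\<close>). This one number controls both the moduli and the
  arguments of the roots \<open>z\<^sub>i\<close> (\<open>root_sums_le_energy\<close>):
  \<open>\<Sum> |ln |z\<^sub>i|| \<le> E(p)\<close> and \<open>|\<Sum> (z\<^sub>i / |z\<^sub>i|)\<^sup>m| \<le> m E(p)\<close> for every \<open>m \<ge> 1\<close>.

  Both bounds come from one auxiliary function. Reflecting the roots inside the unit circle to the
  outside does not change their arguments, and on the unit circle it changes \<open>|p|\<close> only by a constant
  factor. After normalisation this gives \<open>F(u) = \<Prod> (1 - u v\<^sub>i)\<close>, where \<open>v\<^sub>i\<close> is the inverse of the
  reflected root, so \<open>|v\<^sub>i| \<le> 1\<close>; by the maximum principle \<open>|F| \<le> S / (|c\<^sub>n| R)\<close> on the disc, with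
  \<open>R = \<Prod> max 1 |z\<^sub>i|\<close>. As \<open>F(0) = 1\<close>, this says \<open>|c\<^sub>n| R \<le> S\<close>, which is Jensen's inequality and yields
  the first bound. As \<open>F\<close> has no zero in the open disc, \<open>ln F\<close> is holomorphic there with real part at
  most \<open>ln (S / (|c\<^sub>n| R))\<close>, and the Schwarz lemma in the form of Borel and Caratheodory bounds its
  derivative at 0, which is minus the sum of the \<open>v\<^sub>i\<close>. The product of the functions \<open>F(\<zeta> u)\<close> over the
  \<open>m\<close>-th roots of unity \<open>\<zeta>\<close> is \<open>\<Prod> (1 - u\<^sup>m v\<^sub>i\<^sup>m)\<close>, and the same argument applied to it as a function of
  \<open>u\<^sup>m\<close> bounds the \<open>m\<close>-th power sum. This gives the second bound.

  Hence all roots but a number at most \<open>E(p) / \<rho>\<close> lie in the annulus of width \<open>\<rho>\<close>, and if \<open>E(P\<^sub>N) = o(N)\<close>,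
  the exponential averages of the arguments tend to zero, so that the arguments are equidistributed
  by Weyl's criterion (\<open>weyl_equidistribution\<close>).

  It remains to see that the energy is almost surely \<open>o(N)\<close> at a deterministic rate. The series
  \<open>\<Sum> |a\<^sub>k|\<^sup>s / ((1 + \<lambda>\<^sub>k) (k + 1)\<^sup>2)\<close> has finite expectation, so it converges almost surely and
  each \<open>|a\<^sub>k|\<^sup>s\<close> is at most a random constant times the deterministic \<open>(1 + \<lambda>\<^sub>k) (k + 1)\<^sup>2\<close>, whose
  logarithm is \<open>o(k)\<close>; the same holds for \<open>1 / |a\<^sub>k|\<^sup>t\<close>. The result is
  \<open>E(P\<^sub>N) \<le> K + D\<^sub>N\<close> with \<open>K\<close> random and \<open>D\<^sub>N = o(N)\<close> deterministic (\<open>AE_root_energy_sublinear\<close>).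
  The choice \<open>\<alpha>\<^sub>N = min N (sqrt (N D\<^sub>N))\<close> makes both \<open>\<alpha>\<^sub>N / N\<close> and \<open>E(P\<^sub>N) / \<alpha>\<^sub>N\<close> tend to zero.

  The root fractions lie between 0 and 1, so convergence in mean follows by dominated convergence once
  they are known to be random variables. That the number of roots in a Borel set is a measurable
  function of the coefficients is \<open>borel_measurable_root_count\<close>.
\<close>

section \<open>Power sums and the Schwarz lemma\<close>

lemma prod_roots_of_unity:
  fixes x :: complex
  assumes "m \<ge> 1"
  shows "(\<Prod>\<zeta> | \<zeta> ^ m = 1. 1 - \<zeta> * x) = 1 - x ^ m"
proof (cases "x = 0")
  case True
  then show ?thesis using assms by (simp add: zero_power)
next
  case False
  let ?U = "{\<zeta>::complex. \<zeta> ^ m = 1}"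
  have fin: "finite ?U" and card: "card ?U = m"
    using assms by (auto simp: finite_roots_unity card_complex_roots_unity)
  have eq: "(\<Prod>\<zeta>\<in>?U. [:-\<zeta>, 1:]) = monom 1 m - 1" (is "?P = ?Q")
  proof (rule poly_eqI_degree_lead_coeff[where A = ?U and n = m])
    show "degree ?P \<le> m" "coeff ?P m = coeff ?Q m"
    proof -
      have "degree ?P = m" by (subst degree_prod_sum_eq) (use card in auto)
      then show "degree ?P \<le> m" by simp
      have "lead_coeff ?P = 1" by (simp add: lead_coeff_prod)
      then show "coeff ?P m = coeff ?Q m" using \<open>degree ?P = m\<close> assms by simp
    qed
    show "degree ?Q \<le> m"
      using degree_diff_le[of "monom 1 m :: complex poly" m 1] by (simp add: degree_monom_le)
    show "poly ?P z = poly ?Q z" if "z \<in> ?U" for z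
      using that fin by (auto simp: poly_prod poly_monom prod_zero_iff intro!: bexI[of _ z])
  qed (use card in auto)
  have "(\<Prod>\<zeta>\<in>?U. 1 - \<zeta> * x) = (\<Prod>\<zeta>\<in>?U. x * poly [:-\<zeta>, 1:] (inverse x))"
    by (intro prod.cong) (use False in \<open>auto simp: field_simps\<close>)
  also have "\<dots> = x ^ m * poly ?P (inverse x)"
    by (simp add: prod.distrib card poly_prod)
  also have "\<dots> = 1 - x ^ m"
    unfolding eq using False by (simp add: poly_monom field_simps)
  finally show ?thesis .
qed

text \<open>
  The function \<open>G(u) = \<Sum> Ln (1 - u v\<^sub>i)\<close> vanishes at 0, has derivative \<open>- \<Sum> v\<^sub>i\<close> there, and its real part
  is the logarithm of the modulus of the product, hence below any \<open>H > ln C\<close>. The Moebius map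
  \<open>x \<mapsto> x / (2 H - x)\<close> sends the half-plane \<open>Re x < H\<close> into the unit disc and fixes 0, so the Schwarz
  lemma bounds the derivative of the composition by 1.
\<close>

lemma norm_sum_le_of_prod_bound:
  fixes v :: "'i \<Rightarrow> complex"
  assumes fin: "finite I" and v: "\<And>i. i \<in> I \<Longrightarrow> norm (v i) \<le> 1"
    and bound: "\<And>u. norm u < 1 \<Longrightarrow> norm (\<Prod>i\<in>I. 1 - u * v i) \<le> C"
  shows "norm (\<Sum>i\<in>I. v i) \<le> 2 * ln C"
proof -
  have C: "C \<ge> 1" using bound[of 0] by simp
  have le: "norm (\<Sum>i\<in>I. v i) \<le> 2 * H" if H: "H > ln C" for H
  proof -
    have Hpos: "H > 0" using H C by (smt (verit) ln_ge_zero)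
    define G where "G = (\<lambda>u. \<Sum>i\<in>I. Ln (1 - u * v i))"
    define g where "g = (\<lambda>u. G u / (2 * H - G u))"
    have Re_pos: "Re (1 - u * v i) > 0" if "norm u < 1" "i \<in> I" for u i
    proof -
      have "norm (u * v i) < 1"
        using that v[of i] by (metis dual_order.strict_trans2 mult.commute mult_left_le_one_le norm_ge_zero norm_mult)
      then show ?thesis using complex_Re_le_cmod[of "u * v i"] by simp
    qed
    have nonneg: "1 - u * v i \<notin> \<real>\<^sub>\<le>\<^sub>0" if "norm u < 1" "i \<in> I" for u i
      using Re_pos[OF that] by (auto simp: complex_nonpos_Reals_iff)
    have nz: "1 - u * v i \<noteq> 0" if "norm u < 1" "i \<in> I" for u i
      using Re_pos[OF that] by (metis less_irrefl zero_complex.sel(1))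
    have ReG: "Re (G u) < H" if u: "norm u < 1" for u
    proof -
      have "Re (G u) = (\<Sum>i\<in>I. ln (norm (1 - u * v i)))"
        unfolding G_def Re_sum by (intro sum.cong Re_Ln nz u) auto
      also have "\<dots> = ln (\<Prod>i\<in>I. norm (1 - u * v i))"
        by (rule ln_prod[symmetric]) (use fin nz u in auto)
      also have "\<dots> \<le> ln C"
        using bound[OF u] C nz u fin
        by (subst ln_le_cancel_iff) (auto simp flip: prod_norm intro!: prod_pos)
      finally show ?thesis using H by simp
    qed
    have den: "2 * H - G u \<noteq> 0" if "norm u < 1" for u
      using ReG[OF that] Hpos by (auto simp: complex_eq_iff)
    have holG: "G holomorphic_on ball 0 1"
      unfolding G_def by (intro holomorphic_intros) (use nonneg in auto)
    have holg: "g holomorphic_on ball 0 1"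
      unfolding g_def by (intro holomorphic_intros holG) (use den in auto)
    have G0: "G 0 = 0" by (simp add: G_def)
    have less: "norm (g u) < 1" if u: "norm u < 1" for u
    proof -
      have "(norm (G u))\<^sup>2 < (norm (2 * H - G u))\<^sup>2"
      proof -
        have "H * Re (G u) < H * H" using ReG[OF u] Hpos by simp
        then show ?thesis unfolding cmod_power2 by (simp add: power2_eq_square algebra_simps)
      qed
      then have "norm (G u) < norm (2 * H - G u)"
        by (rule power2_less_imp_less) simp
      then show ?thesis unfolding g_def norm_divide using den[OF u] by simp
    qed
    have derG: "(G has_field_derivative - (\<Sum>i\<in>I. v i)) (at 0)"
      unfolding G_def sum_negf[symmetric]
      by (rule derivative_eq_intros refl | simp)+
    have derg: "(g has_field_derivative (- (\<Sum>i\<in>I. v i) / (2 * H))) (at 0)"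
      unfolding g_def by (rule derivative_eq_intros derG refl | use G0 Hpos in \<open>simp add: field_simps power2_eq_square\<close>)+
    have "norm (deriv g 0) \<le> 1"
      by (rule Schwarz_Lemma(2)[OF holg _ less, of 0]) (auto simp: g_def G0)
    then show ?thesis
      using Hpos DERIV_imp_deriv[OF derg] by (simp add: norm_divide norm_mult field_simps)
  qed
  have "norm (\<Sum>i\<in>I. v i) \<le> 2 * ln C + e" if "e > 0" for e
    using le[of "ln C + e / 2"] that by simp
  then show ?thesis by (rule field_le_epsilon)
qed

text \<open>
  The product \<open>\<Prod> (1 - r\<^sup>m v\<^sub>i\<^sup>m)\<close> splits into the \<open>m\<close> rotated products \<open>\<Prod> (1 - \<zeta> r v\<^sub>i)\<close> with \<open>\<zeta>\<^sup>m = 1\<close>,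
  so it is bounded by \<open>C\<^sup>m\<close>. This reduces the \<open>m\<close>-th power sum to the first.
\<close>

lemma norm_power_sum_le_of_prod_bound:
  fixes v :: "'i \<Rightarrow> complex"
  assumes fin: "finite I" and v: "\<And>i. i \<in> I \<Longrightarrow> norm (v i) \<le> 1" and m: "m \<ge> 1"
    and bound: "\<And>u. norm u \<le> 1 \<Longrightarrow> norm (\<Prod>i\<in>I. 1 - u * v i) \<le> C"
  shows "norm (\<Sum>i\<in>I. v i ^ m) \<le> 2 * m * ln C"
proof -
  let ?U = "{\<zeta>::complex. \<zeta> ^ m = 1}"
  have C: "C \<ge> 1" using bound[of 0] by simp
  have card: "card ?U = m" using m by (simp add: card_complex_roots_unity)
  have "norm (\<Sum>i\<in>I. v i ^ m) \<le> 2 * ln (C ^ m)"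
  proof (rule norm_sum_le_of_prod_bound[OF fin])
    show "norm (v i ^ m) \<le> 1" if "i \<in> I" for i
      using v[OF that] by (simp add: norm_power power_le_one)
    show "norm (\<Prod>i\<in>I. 1 - u * v i ^ m) \<le> C ^ m" if u: "norm u < 1" for u
    proof -
      obtain r where r: "r ^ m = u"
        using exists_complex_root[of m u] m by auto
      have nr: "norm r \<le> 1"
      proof (rule ccontr)
        assume "\<not> norm r \<le> 1"
        then have "norm r ^ m \<ge> 1" by (simp add: one_le_power)
        then show False using u r by (metis norm_power not_less)
      qed
      have "(\<Prod>i\<in>I. 1 - u * v i ^ m) = (\<Prod>i\<in>I. \<Prod>\<zeta>\<in>?U. 1 - \<zeta> * (r * v i))"
        using prod_roots_of_unity[OF m] by (simp add: r power_mult_distrib)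
      also have "\<dots> = (\<Prod>\<zeta>\<in>?U. \<Prod>i\<in>I. 1 - (\<zeta> * r) * v i)"
        by (subst prod.swap) (simp add: mult.assoc)
      also have "norm \<dots> \<le> (\<Prod>\<zeta>\<in>?U. C)"
        unfolding prod_norm[symmetric]
      proof (intro prod_mono conjI)
        fix \<zeta> assume "\<zeta> \<in> ?U"
        then have "norm \<zeta> = 1" using m
          using power_eq_1_iff[of \<zeta> m] by auto
        then have "norm (\<zeta> * r) \<le> 1" using nr by (simp add: norm_mult)
        from bound[OF this] show "(\<Prod>i\<in>I. norm (1 - \<zeta> * r * v i)) \<le> C" by (simp add: prod_norm)
      qed (auto intro: prod_nonneg)
      finally show ?thesis by (simp add: card)
    qed
  qed
  then show ?thesis using C by (simp add: ln_realpow)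
qed

section \<open>Moduli and directions of the roots of a polynomial\<close>

text \<open>
  The quantity in the Erdos-Turan theorem on the arguments of the roots, up to a factor 2: the
  logarithm of \<open>\<Sum> |c\<^sub>k| / sqrt (|c\<^sub>0 c\<^sub>n|)\<close>. Like the pair of conclusions drawn from it, it does not change
  when the polynomial is scaled or its coefficients are reversed.
\<close>

definition root_energy :: "complex poly \<Rightarrow> real" where
  "root_energy p = ln ((\<Sum>k\<le>degree p. norm (coeff p k))\<^sup>2 / (norm (coeff p 0) * norm (lead_coeff p)))"

text \<open>
  The two bounds share a budget: with \<open>R = \<Prod> max 1 |z\<^sub>i|\<close> one has exactly
  \<open>E = 2 ln (S / (|c| R)) + \<Sum> |ln |z\<^sub>i||\<close>, where the first summand is nonnegative by Jensen's inequality
  \<open>|c| R \<le> S\<close>. The \<open>m\<close>-th power sum of the \<open>v\<^sub>i\<close> costs \<open>2 m ln (S / (|c| R))\<close>, and replacing \<open>v\<^sub>i\<close> by its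
  direction costs at most \<open>m |ln |z\<^sub>i||\<close> per root, so the total is \<open>m E\<close>.
\<close>

lemma root_sums_le_energy:
  fixes z :: "nat \<Rightarrow> complex"
  assumes p: "p = smult c (\<Prod>i<n. [:- z i, 1:])" and c: "c \<noteq> 0"
    and z: "\<And>i. i < n \<Longrightarrow> z i \<noteq> 0"
  shows "(\<Sum>i<n. \<bar>ln (norm (z i))\<bar>) \<le> root_energy p"
    and "m \<ge> 1 \<Longrightarrow> norm (\<Sum>i<n. sgn (z i) ^ m) \<le> m * root_energy p"
proof -
  define S where "S = (\<Sum>k\<le>degree p. norm (coeff p k))"
  define R where "R = (\<Prod>i<n. max 1 (norm (z i)))"
  define T where "T = (\<Sum>i<n. \<bar>ln (norm (z i))\<bar>)"
  define v where "v = (\<lambda>i. if norm (z i) < 1 then cnj (z i) else inverse (z i))"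
  have zpos: "norm (z i) > 0" if "i < n" for i using z[OF that] by simp
  have Rpos: "R > 0" unfolding R_def by (intro prod_pos) auto
  have lead: "lead_coeff p = c"
    by (simp add: p lead_coeff_prod)
  have p0: "norm (coeff p 0) = norm c * (\<Prod>i<n. norm (z i))"
    unfolding poly_0_coeff_0[symmetric] p by (simp add: poly_prod norm_mult prod_norm[symmetric])
  have prodpos: "(\<Prod>i<n. norm (z i)) > 0" by (intro prod_pos) (use zpos in auto)
  have p0pos: "norm (coeff p 0) > 0" using p0 c prodpos by simp
  have v: "norm (v i) \<le> 1" if "i < n" for i
    using zpos[OF that] by (auto simp: v_def norm_divide field_simps)
  \<comment> \<open>On the circle, the linear factors of a root and of its reflection have moduli in a constant ratio.\<close>
  have factor: "norm (u - z i) = max 1 (norm (z i)) * norm (1 - u * v i)"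
    if u: "norm u = 1" and i: "i < n" for u i
  proof (cases "norm (z i) < 1")
    case True
    have "u * cnj u = 1" using u by (simp add: complex_norm_square[symmetric])
    then have "1 - u * cnj (z i) = u * cnj (u - z i)" by (simp add: algebra_simps)
    then have "norm (1 - u * cnj (z i)) = norm (u - z i)"
      by (simp only: norm_mult complex_mod_cnj u mult_1)
    then show ?thesis using True by (simp add: v_def)
  next
    case False
    have "u - z i = - z i * (1 - u * inverse (z i))" using z[OF i] by (simp add: field_simps)
    then have "norm (u - z i) = norm (z i) * norm (1 - u * inverse (z i))"
      by (simp only: norm_mult norm_minus_cancel)
    then show ?thesis using False by (simp add: v_def max_def)
  qed
  have circle: "norm (\<Prod>i<n. 1 - u * v i) \<le> S / (norm c * R)" if u: "norm u = 1" for u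
  proof -
    have "norm c * R * norm (\<Prod>i<n. 1 - u * v i) = norm (poly p u)"
      unfolding p R_def using u
      by (simp add: poly_prod norm_mult prod_norm[symmetric] prod.distrib[symmetric] factor)
    also have "\<dots> \<le> S"
      unfolding poly_altdef S_def by (rule order_trans[OF norm_sum]) (simp add: norm_mult norm_power u)
    finally show ?thesis using c Rpos by (simp add: field_simps)
  qed
  have disc: "norm (\<Prod>i<n. 1 - u * v i) \<le> S / (norm c * R)" if u: "norm u \<le> 1" for u
  proof (rule maximum_modulus_frontier[where S = "cball 0 1" and f = "\<lambda>u. \<Prod>i<n. 1 - u * v i"])
    show "(\<lambda>u. \<Prod>i<n. 1 - u * v i) holomorphic_on interior (cball 0 1)"
      by (intro holomorphic_intros)
    show "continuous_on (closure (cball 0 1)) (\<lambda>u. \<Prod>i<n. 1 - u * v i)"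
      by (intro continuous_intros)
  qed (use u circle in auto)
  have RS: "norm c * R \<le> S"
    using disc[of 0] c Rpos by (simp add: field_simps)
  have Spos: "S > 0" using RS c Rpos by (smt (verit) mult_pos_pos zero_less_norm_iff)
  have T: "T = 2 * ln R - ln (\<Prod>i<n. norm (z i))"
  proof -
    have "T = (\<Sum>i<n. 2 * ln (max 1 (norm (z i))) - ln (norm (z i)))"
      unfolding T_def by (intro sum.cong) (use zpos in \<open>auto simp: max_def abs_if not_less\<close>)
    also have "\<dots> = 2 * ln R - ln (\<Prod>i<n. norm (z i))"
      unfolding R_def using ln_prod[of "{..<n}" "\<lambda>i. norm (z i)"] zpos
      by (simp add: sum_subtractf sum_distrib_left ln_prod less_max_iff_disj)
    finally show ?thesis .
  qed
  have energy: "root_energy p = 2 * ln (S / (norm c * R)) + T"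
  proof -
    have "root_energy p = 2 * ln S - ln (norm (coeff p 0)) - ln (norm c)"
      unfolding root_energy_def S_def[symmetric] lead using Spos p0pos c
      by (simp add: ln_div ln_mult ln_realpow)
    moreover have "ln (norm (coeff p 0)) = ln (norm c) + ln (\<Prod>i<n. norm (z i))"
      unfolding p0 using c prodpos z by (auto simp: ln_mult)
    moreover have "ln (S / (norm c * R)) = ln S - ln (norm c) - ln R"
      using Spos c Rpos by (simp add: ln_div ln_mult)
    ultimately show ?thesis by (simp add: T)
  qed
  have "ln (S / (norm c * R)) \<ge> 0" using RS c Rpos by simp
  then show "(\<Sum>i<n. \<bar>ln (norm (z i))\<bar>) \<le> root_energy p"
    using energy by (simp add: T_def)
  show "norm (\<Sum>i<n. sgn (z i) ^ m) \<le> m * root_energy p" if m: "m \<ge> 1"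
  proof -
    have close: "norm (cnj (sgn (z i)) ^ m - v i ^ m) \<le> m * \<bar>ln (norm (z i))\<bar>" if i: "i < n" for i
    proof -
      let ?t = "\<bar>ln (norm (z i))\<bar>"
      have "exp (- ?t) = (if norm (z i) < 1 then norm (z i) else inverse (norm (z i)))"
        using zpos[OF i] by (auto simp: abs_if exp_minus)
      then have "v i = of_real (exp (- ?t)) * cnj (sgn (z i))"
        using zpos[OF i] unfolding v_def sgn_eq
        by (auto simp: field_simps complex_norm_square[symmetric] power2_eq_square)
      then have "cnj (sgn (z i)) ^ m - v i ^ m = of_real (1 - exp (- ?t) ^ m) * cnj (sgn (z i)) ^ m"
        by (simp add: power_mult_distrib algebra_simps)
      then have "norm (cnj (sgn (z i)) ^ m - v i ^ m) = \<bar>1 - exp (- ?t) ^ m\<bar>"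
        using z[OF i] by (simp add: norm_mult norm_power norm_sgn del: of_real_diff)
      also have "\<dots> = 1 - exp (m * - ?t)"
        unfolding exp_of_nat_mult by (simp add: power_le_one)
      also have "\<dots> \<le> m * ?t" using exp_ge_add_one_self[of "m * - ?t"] by linarith
      finally show ?thesis .
    qed
    \<comment> \<open>The \<open>v i\<close> point along the conjugated roots, so the conjugated sum is the one to compare with.\<close>
    have "(\<Sum>i<n. v i ^ m) + (\<Sum>i<n. cnj (sgn (z i)) ^ m - v i ^ m) = cnj (\<Sum>i<n. sgn (z i) ^ m)"
      by (simp add: sum_subtractf)
    then have "norm (\<Sum>i<n. sgn (z i) ^ m) =
        norm ((\<Sum>i<n. v i ^ m) + (\<Sum>i<n. cnj (sgn (z i)) ^ m - v i ^ m))"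
      by (simp only: complex_mod_cnj)
    also have "\<dots> \<le> 2 * m * ln (S / (norm c * R)) + (\<Sum>i<n. m * \<bar>ln (norm (z i))\<bar>)"
    proof (intro order_trans[OF norm_triangle_ineq] add_mono)
      show "norm (\<Sum>i<n. v i ^ m) \<le> 2 * m * ln (S / (norm c * R))"
        using norm_power_sum_le_of_prod_bound[where I = "{..<n}" and v = v and C = "S / (norm c * R)", OF _ _ m]
          disc v by simp
      show "norm (\<Sum>i<n. cnj (sgn (z i)) ^ m - v i ^ m) \<le> (\<Sum>i<n. m * \<bar>ln (norm (z i))\<bar>)"
        by (rule order_trans[OF norm_sum]) (intro sum_mono close, simp)
    qed
    also have "\<dots> = m * root_energy p"
      unfolding energy T_def by (simp add: sum_distrib_left algebra_simps)
    finally show ?thesis .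
  qed
qed

section \<open>Weyl's criterion on the circle\<close>

text \<open>
  Functions of the angle rather than of the point on the circle: \<open>cis (k x) * cis (l x)\<close> is a generator
  again for every \<open>x\<close>, whereas exponents of \<open>z powi k\<close> add up only for \<open>z \<noteq> 0\<close>.
\<close>

inductive trig_polynomial :: "(real \<Rightarrow> complex) \<Rightarrow> bool" where
  monom: "trig_polynomial (\<lambda>x. c * cis (of_int k * x))"
| add: "trig_polynomial f \<Longrightarrow> trig_polynomial g \<Longrightarrow> trig_polynomial (\<lambda>x. f x + g x)"

lemma trig_polynomial_mult:
  assumes "trig_polynomial f" "trig_polynomial g"
  shows "trig_polynomial (\<lambda>x. f x * g x)"
  using assms(1)
proof induction
  case (monom c k)
  show ?case using assms(2)
  proof induction
    case (monom d l)
    have "(\<lambda>x. c * cis (of_int k * x) * (d * cis (of_int l * x))) =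
          (\<lambda>x. (c * d) * cis (of_int (k + l) * x))"
      by (simp add: cis_mult[symmetric] algebra_simps)
    then show ?case using trig_polynomial.monom[of "c * d" "k + l"] by simp
  next
    case (add f g)
    then show ?case by (simp add: distrib_left trig_polynomial.add)
  qed
next
  case (add f g)
  then show ?case by (simp add: distrib_right trig_polynomial.add)
qed

text \<open>
  This lets the Weierstrass approximation theorem for polynomials in the two real coordinates serve
  as the density of trigonometric polynomials.
\<close>

lemma trig_polynomial_of_real_polynomial:
  fixes p :: "complex \<Rightarrow> real"
  assumes "real_polynomial_function p"
  shows "trig_polynomial (\<lambda>x. of_real (p (cis x)))"
  using assms
proof induction
  case (linear f)
  interpret bounded_linear f by fact
  define c where "c = complex_of_real (f 1) / 2 - \<i> * of_real (f \<i>) / 2"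
  have "complex_of_real (f (cis x)) = c * cis (of_int 1 * x) + cnj c * cis (of_int (- 1) * x)" for x
  proof -
    have "cis x = cos x *\<^sub>R 1 + sin x *\<^sub>R \<i>" by (simp add: complex_eq_iff)
    then have "f (cis x) = cos x * f 1 + sin x * f \<i>"
      by (simp only: add scaleR real_scaleR_def)
    then show ?thesis by (simp add: c_def complex_eq_iff field_simps)
  qed
  then show ?case by (simp only:) (intro trig_polynomial.intros)
next
  case (const c)
  then show ?case using trig_polynomial.monom[of "of_real c" 0] by simp
next
  case (add f g)
  then show ?case by (simp add: trig_polynomial.add)
next
  case (mult f g)
  then show ?case by (simp add: trig_polynomial_mult)
qed

definition exp_sums_vanish :: "(nat \<Rightarrow> nat \<Rightarrow> real) \<Rightarrow> bool" where
  "exp_sums_vanish x \<longleftrightarrow> (\<forall>m\<ge>1. (\<lambda>N. (\<Sum>i<N. cis (of_nat m * x N i)) / of_nat N) \<longlonglongrightarrow> 0)"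

text \<open>
  Both the integral over a period and the limit of the averages are linear and vanish on
  \<open>cis (k x)\<close> for \<open>k \<noteq> 0\<close>; for negative \<open>k\<close> the averages are conjugates of those for \<open>- k\<close>. The period may
  start anywhere, so that later an arc can be placed at its beginning.
\<close>

lemma trig_polynomial_average:
  assumes x: "exp_sums_vanish x" and f: "trig_polynomial f"
  shows "\<exists>J. (f has_integral J) {a..a + 2 * pi} \<and>
             (\<lambda>N. (\<Sum>i<N. f (x N i)) / of_nat N) \<longlonglongrightarrow> J / (2 * pi)"
  using f
proof induction
  case (monom c k)
  have mean: "(\<lambda>N. (\<Sum>i<N. cis (of_nat m * x N i)) / of_nat N) \<longlonglongrightarrow> 0" if "m \<ge> 1" for m
    using x that by (auto simp: exp_sums_vanish_def)
  show ?case
  proof (cases "k = 0")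
    case True
    have "((\<lambda>x. c) has_integral (2 * pi) *\<^sub>R c) {a..a + 2 * pi}"
      using has_integral_const_real[of c a "a + 2 * pi"] by simp
    moreover have "(\<lambda>N. (\<Sum>i<N. c) / of_nat N) \<longlonglongrightarrow> c"
      by (rule tendsto_eventually, rule eventually_mono[OF eventually_gt_at_top[of 0]]) auto
    ultimately show ?thesis using True by (intro exI[of _ "(2 * pi) *\<^sub>R c"]) (auto simp: scaleR_conv_of_real)
  next
    case False
    have "((\<lambda>x. c * cis (of_int k * x)) has_integral
        (c * cis (of_int k * (a + 2 * pi)) / (\<i> * of_int k) - c * cis (of_int k * a) / (\<i> * of_int k)))
        {a..a + 2 * pi}"
    proof (rule fundamental_theorem_of_calculus)
      fix t :: real
      have "((\<lambda>z. c * exp (\<i> * of_int k * z) / (\<i> * of_int k)) has_field_derivative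
          c * exp (\<i> * of_int k * of_real t)) (at (of_real t))"
        using False by (auto intro!: derivative_eq_intros)
      then have "((\<lambda>x. c * exp (\<i> * of_int k * of_real x) / (\<i> * of_int k)) has_vector_derivative
          c * exp (\<i> * of_int k * of_real t)) (at t within {a..a + 2 * pi})"
        by (rule has_vector_derivative_real_field)
      then show "((\<lambda>x. c * cis (of_int k * x) / (\<i> * of_int k)) has_vector_derivative
          c * cis (of_int k * t)) (at t within {a..a + 2 * pi})"
        by (simp add: cis_conv_exp mult.assoc)
    qed simp
    moreover have "cis (of_int k * (a + 2 * pi)) = cis (of_int k * a)"
      using cis_multiple_2pi[of "of_int k"] by (simp add: distrib_left cis_mult[symmetric] mult_ac)
    ultimately have int: "((\<lambda>x. c * cis (of_int k * x)) has_integral 0) {a..a + 2 * pi}" by simp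
    have "(\<lambda>N. (\<Sum>i<N. cis (of_int k * x N i)) / of_nat N) \<longlonglongrightarrow> 0"
    proof (cases "k > 0")
      case True
      then show ?thesis using mean[of "nat k"] by simp
    next
      case False
      then have "(\<lambda>N. cnj ((\<Sum>i<N. cis (of_int (- k) * x N i)) / of_nat N)) \<longlonglongrightarrow> cnj 0"
        using mean[of "nat (- k)"] \<open>k \<noteq> 0\<close> by (intro tendsto_cnj) simp
      then show ?thesis by (simp add: cis_cnj)
    qed
    from tendsto_mult_left[OF this, of c]
    have "(\<lambda>N. (\<Sum>i<N. c * cis (of_int k * x N i)) / of_nat N) \<longlonglongrightarrow> 0"
      by (simp add: sum_distrib_left)
    then show ?thesis using int by (intro exI[of _ 0]) auto
  qed
next
  case (add f g)
  then obtain J K where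
    "(f has_integral J) {a..a + 2 * pi}" "(\<lambda>N. (\<Sum>i<N. f (x N i)) / of_nat N) \<longlonglongrightarrow> J / (2 * pi)"
    "(g has_integral K) {a..a + 2 * pi}" "(\<lambda>N. (\<Sum>i<N. g (x N i)) / of_nat N) \<longlonglongrightarrow> K / (2 * pi)"
    by blast
  then show ?case
    by (intro exI[of _ "J + K"])
       (auto simp: sum.distrib add_divide_distrib intro!: has_integral_add tendsto_add)
qed

text \<open>
  The bumps decrease to the indicator of the closed arc. Only the right end point of the period can
  lie on the arc without its angle lying in \<open>{a..b}\<close>.
\<close>

lemma bump_integral_tendsto:
  assumes ab: "a \<le> b" "b \<le> a + 2 * pi"
  defines "g \<equiv> \<lambda>n z. max 0 (1 - real n * infdist z (cis ` {a..b}))"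
  shows "(\<lambda>n. integral {a..a + 2 * pi} (\<lambda>t. g n (cis t))) \<longlonglongrightarrow> b - a"
proof -
  let ?K = "cis ` {a..b}" and ?S = "{a..a + 2 * pi}"
  have K: "closed ?K" "?K \<noteq> {}"
    using ab by (auto intro!: compact_imp_closed compact_continuous_image continuous_intros)
  define h where "h = (\<lambda>t. if cis t \<in> ?K then 1 else 0 :: real)"
  have lim: "(\<lambda>n. integral ?S (\<lambda>t. g n (cis t))) \<longlonglongrightarrow> integral ?S h"
  proof (rule dominated_convergence(2)[where h = "\<lambda>_. 1"])
    show "(\<lambda>t. g n (cis t)) integrable_on ?S" for n
      unfolding g_def by (intro integrable_continuous_real continuous_intros)
    show "norm (g n (cis t)) \<le> 1" for n t
      unfolding g_def by (auto simp: infdist_nonneg)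
    show "(\<lambda>n. g n (cis t)) \<longlonglongrightarrow> h t" for t
    proof (cases "cis t \<in> ?K")
      case True
      then show ?thesis by (simp add: g_def h_def)
    next
      case False
      then have pos: "infdist (cis t) ?K > 0"
        using K by (metis in_closed_iff_infdist_zero infdist_nonneg less_eq_real_def)
      have "filterlim (\<lambda>n. real n * infdist (cis t) ?K) at_top sequentially"
        using filterlim_real_sequentially pos
        by (simp add: filterlim_tendsto_pos_mult_at_top[OF tendsto_const] mult.commute[of _ "infdist (cis t) ?K"])
      then have "eventually (\<lambda>n. real n * infdist (cis t) ?K \<ge> 1) sequentially"
        by (simp add: filterlim_at_top)
      then have "eventually (\<lambda>n. g n (cis t) = h t) sequentially"
        by eventually_elim (use False in \<open>simp add: g_def h_def\<close>)
      then show ?thesis by (rule tendsto_eventually)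
    qed
  qed auto
  have "((\<lambda>t. if t \<in> {a..b} then 1 else 0 :: real) has_integral (b - a)) ?S"
    using has_integral_restrict[of "{a..b}" ?S "\<lambda>_. 1 :: real" "b - a"] has_integral_const_real[of "1 :: real" a b] ab
    by simp
  then have "(h has_integral (b - a)) ?S"
  proof (rule has_integral_spike_finite[rotated 2])
    fix t assume t: "t \<in> ?S - {a + 2 * pi}"
    have "t \<in> {a..b}" if ct: "cis t \<in> ?K"
    proof -
      obtain s where s: "s \<in> {a..b}" "cis t = cis s" using ct by auto
      then obtain k where k: "t = s + of_int k * (2 * pi)"
        using cis_eq_iff[of s t] unfolding rcong_altdef by auto
      have st: "a \<le> s" "s \<le> b" "a \<le> t" "t < a + 2 * pi" using s(1) t by auto
      show ?thesis
      proof (cases "k = 0")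
        case True
        then show ?thesis using k s by simp
      next
        case False
        then consider "k \<ge> 1" | "k \<le> -1" by linarith
        then show ?thesis
        proof cases
          case 1
          then have "real_of_int k * (2 * pi) \<ge> 2 * pi" by simp
          then show ?thesis using k st ab unfolding atLeastAtMost_iff by linarith
        next
          case 2
          then have "real_of_int k * (2 * pi) \<le> - 1 * (2 * pi)" by (intro mult_right_mono) auto
          then show ?thesis using k st ab unfolding atLeastAtMost_iff by linarith
        qed
      qed
    qed
    then have "cis t \<in> ?K \<longleftrightarrow> t \<in> {a..b}" by blast
    then show "h t = (if t \<in> {a..b} then 1 else 0)" by (simp only: h_def)
  qed simp
  then show ?thesis using lim by (simp add: integral_unique)
qed

text \<open>
  A continuous bump slightly larger than the indicator of the arc is approximated from above by a
  trigonometric polynomial, for which the averages converge. Only this upper bound is asked for: the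
  lower bound for an arc is the upper bound for the complementary arc.
\<close>

lemma closed_arc_fraction_le:
  assumes x: "exp_sums_vanish x" and ab: "a \<le> b" "b \<le> a + 2 * pi" and e: "e > 0"
  shows "eventually (\<lambda>N. card {i. i < N \<and> cis (x N i) \<in> cis ` {a..b}} / N \<le> (b - a) / (2 * pi) + e) sequentially"
proof -
  let ?K = "cis ` {a..b}"
  define g where "g = (\<lambda>n z. max 0 (1 - real n * infdist z ?K))"
  define d where "d = e / 4"
  have d: "d > 0" using e by (simp add: d_def)
  have "eventually (\<lambda>n. integral {a..a + 2 * pi} (\<lambda>t. g n (cis t)) < (b - a) + 2 * pi * d) sequentially"
    using bump_integral_tendsto[OF ab] d unfolding g_def by (intro order_tendstoD) (auto simp: add_pos_pos)
  then obtain n where n: "integral {a..a + 2 * pi} (\<lambda>t. g n (cis t)) < (b - a) + 2 * pi * d"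
    by (auto simp: eventually_sequentially)
  have cont: "continuous_on UNIV (g n)" unfolding g_def by (intro continuous_intros)
  \<comment> \<open>The shift by \<open>d\<close> makes the approximation one-sided: \<open>g \<le> p \<le> g + 2 d\<close>.\<close>
  obtain p where p: "real_polynomial_function p" "\<And>z. z \<in> sphere 0 1 \<Longrightarrow> \<bar>(g n z + d) - p z\<bar> < d"
  proof (rule Stone_Weierstrass_real_polynomial_function)
    show "continuous_on (sphere 0 1) (\<lambda>z::complex. g n z + d)"
      by (intro continuous_intros continuous_on_subset[OF cont]) auto
  qed (use d in auto)
  have p_lower: "g n (cis t) \<le> p (cis t)" and p_upper: "p (cis t) \<le> g n (cis t) + 2 * d" for t
    using p(2)[of "cis t"] by auto
  obtain J where J: "((\<lambda>t. complex_of_real (p (cis t))) has_integral J) {a..a + 2 * pi}"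
    and avg: "(\<lambda>N. (\<Sum>i<N. complex_of_real (p (cis (x N i)))) / of_nat N) \<longlonglongrightarrow> J / (2 * pi)"
    using trig_polynomial_average[OF x trig_polynomial_of_real_polynomial[OF p(1)]] by blast
  have intp: "((\<lambda>t. p (cis t)) has_integral Re J) {a..a + 2 * pi}"
    using has_integral_Re[OF J] by simp
  have intg: "((\<lambda>t. g n (cis t) + 2 * d) has_integral
      (integral {a..a + 2 * pi} (\<lambda>t. g n (cis t)) + (2 * pi) * (2 * d))) {a..a + 2 * pi}"
  proof (rule has_integral_add)
    show "((\<lambda>t. g n (cis t)) has_integral integral {a..a + 2 * pi} (\<lambda>t. g n (cis t))) {a..a + 2 * pi}"
      by (intro integrable_integral integrable_continuous_real continuous_on_compose2[OF cont] continuous_intros) auto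
    show "((\<lambda>t. 2 * d) has_integral (2 * pi) * (2 * d)) {a..a + 2 * pi}"
      using has_integral_const_real[of "2 * d" a "a + 2 * pi"] by simp
  qed
  have "Re J \<le> integral {a..a + 2 * pi} (\<lambda>t. g n (cis t)) + (2 * pi) * (2 * d)"
    by (rule has_integral_le[OF intp intg]) (rule p_upper)
  then have "Re J < (b - a) + 2 * pi * (3 * d)" using n by (simp add: algebra_simps)
  then have "Re J / (2 * pi) < ((b - a) + 2 * pi * (3 * d)) / (2 * pi)"
    by (intro divide_strict_right_mono) auto
  also have "\<dots> = (b - a) / (2 * pi) + 3 * d" by (simp add: add_divide_distrib)
  also have "\<dots> < (b - a) / (2 * pi) + e" using e by (simp add: d_def)
  finally have Jlt: "Re J / (2 * pi) < (b - a) / (2 * pi) + e" .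
  have "(\<lambda>N. Re ((\<Sum>i<N. complex_of_real (p (cis (x N i)))) / of_nat N)) \<longlonglongrightarrow> Re (J / (2 * pi))"
    by (rule tendsto_Re[OF avg])
  then have "(\<lambda>N. (\<Sum>i<N. p (cis (x N i))) / N) \<longlonglongrightarrow> Re J / (2 * pi)"
    by (simp only: Re_divide_of_nat Re_divide_of_real Re_sum Re_complex_of_real)
  then have "eventually (\<lambda>N. (\<Sum>i<N. p (cis (x N i))) / N < (b - a) / (2 * pi) + e) sequentially"
    using Jlt by (rule order_tendstoD)
  then show ?thesis
  proof eventually_elim
    case (elim N)
    have "real (card {i. i < N \<and> cis (x N i) \<in> ?K}) = (\<Sum>i<N. if cis (x N i) \<in> ?K then 1 else 0)"
      by (simp add: sum.If_cases Int_def)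
    also have "\<dots> \<le> (\<Sum>i<N. p (cis (x N i)))"
    proof (rule sum_mono)
      fix i
      have "(if cis (x N i) \<in> ?K then 1 else 0) \<le> g n (cis (x N i))" by (auto simp: g_def)
      then show "(if cis (x N i) \<in> ?K then 1 else 0) \<le> p (cis (x N i))" using p_lower order_trans by blast
    qed
    finally show ?case using elim by (smt (verit) divide_right_mono of_nat_0_le_iff)
  qed
qed

text \<open>
  The half-open arc lies in the closed arc from \<open>\<theta>\<close> to \<open>\<phi>\<close>, and its complement in the closed arc from
  \<open>\<phi>\<close> to \<open>\<theta> + 2 \<pi>\<close>. The two upper bounds add up to 1, so both are attained in the limit.
\<close>

lemma weyl_equidistribution:
  assumes x: "exp_sums_vanish x" and range: "\<And>N i. x N i \<in> {0..<2 * pi}"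
    and \<theta>\<phi>: "0 \<le> \<theta>" "\<theta> < \<phi>" "\<phi> \<le> 2 * pi"
  shows "(\<lambda>N. card {i. i < N \<and> \<theta> \<le> x N i \<and> x N i < \<phi>} / N) \<longlonglongrightarrow> (\<phi> - \<theta>) / (2 * pi)"
proof (rule LIMSEQ_I)
  fix e :: real assume e: "e > 0"
  define A where "A = (\<lambda>N. {i. i < N \<and> \<theta> \<le> x N i \<and> x N i < \<phi>})"
  define B where "B = (\<lambda>N. {i. i < N \<and> \<not> (\<theta> \<le> x N i \<and> x N i < \<phi>)})"
  have upper: "eventually (\<lambda>N. card {i. i < N \<and> cis (x N i) \<in> cis ` {\<theta>..\<phi>}} / N \<le> (\<phi> - \<theta>) / (2 * pi) + e / 2) sequentially"
    by (rule closed_arc_fraction_le[OF x]) (use \<theta>\<phi> e in auto)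
  have lower: "eventually (\<lambda>N. card {i. i < N \<and> cis (x N i) \<in> cis ` {\<phi>..\<theta> + 2 * pi}} / N \<le> (\<theta> + 2 * pi - \<phi>) / (2 * pi) + e / 2) sequentially"
    by (rule closed_arc_fraction_le[OF x]) (use \<theta>\<phi> e in auto)
  have "eventually (\<lambda>N. norm (card (A N) / N - (\<phi> - \<theta>) / (2 * pi)) < e) sequentially"
    using upper lower eventually_gt_at_top[of 0]
  proof eventually_elim
    case (elim N)
    have "card (A N) \<le> card {i. i < N \<and> cis (x N i) \<in> cis ` {\<theta>..\<phi>}}"
      by (intro card_mono) (auto simp: A_def)
    then have 1: "card (A N) / N \<le> (\<phi> - \<theta>) / (2 * pi) + e / 2"
      using elim(1) by (smt (verit) divide_right_mono of_nat_0_le_iff of_nat_le_iff)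
    have "cis (x N i) \<in> cis ` {\<phi>..\<theta> + 2 * pi}" if "i \<in> B N" for i
    proof (cases "x N i < \<theta>")
      case True
      have "cis (x N i) = cis (x N i + 2 * pi)" by (simp add: cis_mult[symmetric])
      moreover have "x N i + 2 * pi \<in> {\<phi>..\<theta> + 2 * pi}" using True range[of N i] \<theta>\<phi> by auto
      ultimately show ?thesis by (rule image_eqI)
    next
      case False
      then have "x N i \<in> {\<phi>..\<theta> + 2 * pi}" using that range[of N i] \<theta>\<phi> by (auto simp: B_def)
      then show ?thesis by (rule imageI)
    qed
    then have "card (B N) \<le> card {i. i < N \<and> cis (x N i) \<in> cis ` {\<phi>..\<theta> + 2 * pi}}"
      by (intro card_mono) (auto simp: B_def)
    then have 2: "card (B N) / N \<le> (\<theta> + 2 * pi - \<phi>) / (2 * pi) + e / 2"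
      using elim(2) by (smt (verit) divide_right_mono of_nat_0_le_iff of_nat_le_iff)
    have "card (A N) + card (B N) = card (A N \<union> B N)"
      by (intro card_Un_disjoint[symmetric]) (auto simp: A_def B_def)
    also have "A N \<union> B N = {..<N}" by (auto simp: A_def B_def)
    finally have "real (card (A N)) + real (card (B N)) = N"
      by (simp flip: of_nat_add)
    then have "card (A N) / N + card (B N) / N = 1"
      using elim(3) by (simp add: add_divide_distrib[symmetric])
    moreover have "(\<theta> + 2 * pi - \<phi>) / (2 * pi) = 1 - (\<phi> - \<theta>) / (2 * pi)"
      by (simp add: field_simps)
    ultimately show ?case using 1 2 e by (simp add: abs_less_iff)
  qed
  then show "\<exists>n0. \<forall>N\<ge>n0. norm (card {i. i < N \<and> \<theta> \<le> x N i \<and> x N i < \<phi>} / N - (\<phi> - \<theta>) / (2 * pi)) < e"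
    by (simp add: eventually_sequentially A_def)
qed

section \<open>Measurability of root counts\<close>

abbreviation root_count :: "complex poly \<Rightarrow> complex set \<Rightarrow> nat" where
  "root_count p B \<equiv> size {#z \<in># proots p. z \<in> B#}"

lemma size_filter_image_lessThan:
  fixes n :: nat
  shows "size {#z \<in># image_mset f (mset_set {..<n}). P z#} = card {i. i < n \<and> P (f i)}"
  unfolding filter_mset_image_mset size_image_mset
  by (subst filter_mset_mset_set) simp_all

lemma compact_function_box:
  fixes S :: "nat \<Rightarrow> 'c::topological_space set"
  assumes "\<And>i. compact (S i)"
  shows "compact {f. \<forall>i. f i \<in> S i}"
proof -
  have "compactin (product_topology (\<lambda>_. euclidean) UNIV) (PiE UNIV S)"
    unfolding compactin_PiE using assms by simp
  moreover have "PiE UNIV S = {f. \<forall>i. f i \<in> S i}" by auto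
  ultimately show ?thesis by (simp add: euclidean_product_topology)
qed

lemma continuous_on_coeff_prod_linear:
  "continuous_on UNIV (\<lambda>z :: nat \<Rightarrow> complex. coeff (\<Prod>i<n. [:- z i, 1:]) k)"
proof (induction n arbitrary: k)
  case 0
  then show ?case by simp
next
  case (Suc n)
  have "coeff (\<Prod>i<Suc n. [:- z i, 1:]) k =
      (case k of 0 \<Rightarrow> 0 | Suc l \<Rightarrow> coeff (\<Prod>i<n. [:- z i, 1:]) l) - z n * coeff (\<Prod>i<n. [:- z i, 1:]) k"
    for z :: "nat \<Rightarrow> complex"
    by (simp add: coeff_pCons split: nat.split)
  then show ?case
    by (cases k) (auto intro!: continuous_intros Suc.IH continuous_on_product_coordinates)
qed

text \<open>
  Listing the roots in \<open>K\<close> first turns a count into a statement about one enumeration of all roots, that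
  is, about a point of a product space.
\<close>

lemma monic_root_count_ge_iff:
  fixes q :: "complex poly"
  assumes q: "lead_coeff q = 1" "degree q = n" and j: "j \<le> n"
  shows "j \<le> root_count q K \<longleftrightarrow> (\<exists>z. (\<forall>i<j. z i \<in> K) \<and> coeff (\<Prod>i<n. [:- z i, 1:]) = coeff q)"
proof
  assume le: "j \<le> root_count q K"
  obtain ys where ys: "mset ys = {#z \<in># proots q. z \<in> K#}" using ex_mset by blast
  obtain zs where zs: "mset zs = {#z \<in># proots q. z \<notin> K#}" using ex_mset by blast
  have mset: "mset (ys @ zs) = proots q" unfolding mset_append ys zs by (rule multiset_partition[symmetric])
  then have len: "length (ys @ zs) = n" using q by (metis size_mset size_proots_complex)
  have lys: "j \<le> length ys" using le ys by (metis size_mset)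
  have setys: "set ys \<subseteq> K"
    using arg_cong[OF ys, of set_mset] by auto
  define xs where "xs = ys @ zs"
  have "q = smult (lead_coeff q) (\<Prod>x\<in>#proots q. [:- x, 1:])"
    by (rule complex_poly_decompose_multiset[symmetric])
  also have "\<dots> = (\<Prod>x\<leftarrow>xs. [:- x, 1:])"
    unfolding q(1) mset[symmetric] xs_def[symmetric] by (simp flip: prod_mset_prod_list mset_map)
  also have "\<dots> = (\<Prod>i<length xs. [:- xs ! i, 1:])"
    by (subst prod.list_conv_set_nth) (auto simp: atLeast0LessThan)
  finally have "coeff (\<Prod>i<n. [:- (ys @ zs) ! i, 1:]) = coeff q"
    using len by (simp add: xs_def)
  moreover have "\<forall>i<j. (ys @ zs) ! i \<in> K"
    using lys setys by (auto simp: nth_append)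
  ultimately show "\<exists>z. (\<forall>i<j. z i \<in> K) \<and> coeff (\<Prod>i<n. [:- z i, 1:]) = coeff q" by blast
next
  assume "\<exists>z. (\<forall>i<j. z i \<in> K) \<and> coeff (\<Prod>i<n. [:- z i, 1:]) = coeff q"
  then obtain z where z: "\<forall>i<j. z i \<in> K" and eq: "q = (\<Prod>i<n. [:- z i, 1:])"
    by (metis coeff_inject)
  have "proots q = image_mset z (mset_set {..<n})"
    unfolding eq by (subst proots_prod) (auto simp: sum_unfold_sum_mset)
  then have "root_count q K = card {i. i < n \<and> z i \<in> K}"
    by (simp add: size_filter_image_lessThan)
  moreover have "card {..<j} \<le> card {i. i < n \<and> z i \<in> K}"
    using z j by (intro card_mono) auto
  ultimately show "j \<le> root_count q K" by simp
qed

text \<open>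
  The coefficients of a monic polynomial depend continuously on its roots. The admissible root
  vectors form a countable union of compact boxes, so their image is a countable union of compact sets.
\<close>

lemma coefficients_with_roots_in_closed_borel:
  fixes K :: "complex set"
  assumes K: "closed K" and j: "j \<le> n"
  shows "{b. \<exists>z :: nat \<Rightarrow> complex. (\<forall>i<j. z i \<in> K) \<and> coeff (\<Prod>i<n. [:- z i, 1:]) = b} \<in> sets borel" (is "?E \<in> _")
proof -
  define \<Phi> where "\<Phi> = (\<lambda>z :: nat \<Rightarrow> complex. coeff (\<Prod>i<n. [:- z i, 1:]))"
  define Box where "Box = (\<lambda>R. {z. \<forall>i. z i \<in> (if i < j then K \<inter> cball 0 (real R) else cball 0 (real R))})"
  have "?E = (\<Union>R. \<Phi> ` Box R)"
  proof (intro equalityI subsetI)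
    fix b assume "b \<in> ?E"
    then obtain z where z: "\<forall>i<j. z i \<in> K" "b = \<Phi> z" by (auto simp: \<Phi>_def)
    \<comment> \<open>Setting the coordinates from \<open>n\<close> on to 0 keeps the product and makes the vector bounded.\<close>
    define y where "y = (\<lambda>i. if i < n then z i else 0)"
    obtain R where R: "real R \<ge> Max (insert 0 ((\<lambda>i. norm (z i)) ` {..<n}))"
      using real_arch_simple by blast
    then have "norm (z i) \<le> R" if "i < n" for i
      using that by (subst (asm) Max_le_iff) auto
    then have "y \<in> Box R" using z(1) j by (auto simp: Box_def y_def)
    moreover have "\<Phi> y = b" unfolding z(2) \<Phi>_def y_def by simp
    ultimately show "b \<in> (\<Union>R. \<Phi> ` Box R)" by blast
  next
    fix b assume "b \<in> (\<Union>R. \<Phi> ` Box R)"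
    then obtain R z where z: "z \<in> Box R" "b = \<Phi> z" by blast
    have "z i \<in> K" if "i < j" for i
      using z(1) that by (auto simp: Box_def dest: spec[of _ i])
    then show "b \<in> ?E" using z(2) by (auto simp: \<Phi>_def)
  qed
  moreover have "compact (\<Phi> ` Box R)" for R
  proof (rule compact_continuous_image)
    have "continuous_on UNIV \<Phi>"
      unfolding \<Phi>_def by (intro continuous_on_coordinatewise_then_product continuous_on_coeff_prod_linear)
    then show "continuous_on (Box R) \<Phi>" by (rule continuous_on_subset) simp
    show "compact (Box R)"
      unfolding Box_def using K by (intro compact_function_box) (auto intro: closed_Int_compact)
  qed
  then have "\<Phi> ` Box R \<in> sets borel" for R
    by (intro borel_closed compact_imp_closed)
  ultimately show ?thesis by simp
qed

text \<open>
  The degree may vary with the sample point, so the space is cut into the events \<open>D n\<close> on which it is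
  \<open>n\<close>. There the polynomial is divided by its leading coefficient and the monic case applies. The event
  where the polynomial vanishes contributes no roots.
\<close>

lemma borel_measurable_root_count_closed:
  fixes p :: "'w \<Rightarrow> complex poly"
  assumes coeff [measurable]: "\<And>k. (\<lambda>w. coeff (p w) k) \<in> borel_measurable M" and K: "closed K"
  shows "(\<lambda>w. real (root_count (p w) K)) \<in> borel_measurable M"
proof -
  define D where "D = (\<lambda>n. {w \<in> space M. coeff (p w) n \<noteq> 0 \<and> (\<forall>k. k > n \<longrightarrow> coeff (p w) k = 0)})"
  define E where "E = (\<lambda>(n :: nat) (j :: nat). {b. \<exists>z :: nat \<Rightarrow> complex. (\<forall>i<j. z i \<in> K) \<and> coeff (\<Prod>i<n. [:- z i, 1:]) = b})"
  define b where "b = (\<lambda>n w k. coeff (p w) k / coeff (p w) n)"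
  have [measurable]: "D n \<in> sets M" for n unfolding D_def by measurable
  have [measurable]: "b n \<in> borel_measurable M" for n
    unfolding b_def by (intro measurable_coordinatewise_then_product) measurable
  have iff: "j \<le> root_count (p w) K \<longleftrightarrow> j \<le> n \<and> b n w \<in> E n j" if w: "w \<in> D n" for w n j
  proof -
    define q where "q = smult (inverse (coeff (p w) n)) (p w)"
    have deg: "degree (p w) = n"
      using w by (intro antisym degree_le le_degree) (auto simp: D_def)
    have nz: "coeff (p w) n \<noteq> 0" using w by (simp add: D_def)
    have q: "lead_coeff q = 1" "degree q = n" "coeff q = b n w" "proots q = proots (p w)"
      using deg nz by (auto simp: q_def b_def field_simps)
    show ?thesis
    proof (cases "j \<le> n")
      case True
      then show ?thesis using monic_root_count_ge_iff[OF q(1,2) True, of K] q by (simp add: E_def)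
    next
      case False
      have "root_count (p w) K \<le> n"
        using size_filter_mset_lesseq[of "\<lambda>z. z \<in> K" "proots (p w)"] deg by (simp add: size_proots_complex)
      then show ?thesis using False by auto
    qed
  qed
  have "{w \<in> space M. a \<le> real (root_count (p w) K)} \<in> sets M" for a
  proof (cases "a \<le> 0")
    case True
    then have "{w \<in> space M. a \<le> real (root_count (p w) K)} = space M" by (auto intro: order_trans)
    then show ?thesis by simp
  next
    case False
    define j where "j = nat \<lceil>a\<rceil>"
    have j: "a \<le> real m \<longleftrightarrow> j \<le> m" for m using False by (simp add: j_def nat_le_iff ceiling_le_iff)
    have jpos: "j > 0" using False by (simp add: j_def)
    have "{w \<in> space M. a \<le> real (root_count (p w) K)} = (\<Union>n\<in>{j..}. {w \<in> D n. b n w \<in> E n j})"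
    proof (intro equalityI subsetI)
      fix w assume "w \<in> {w \<in> space M. a \<le> real (root_count (p w) K)}"
      then have w: "w \<in> space M" "j \<le> root_count (p w) K" by (auto simp: j)
      then have "p w \<noteq> 0" using jpos by auto
      then have "w \<in> D (degree (p w))" using w(1) by (auto simp: D_def coeff_eq_0)
      then show "w \<in> (\<Union>n\<in>{j..}. {w \<in> D n. b n w \<in> E n j})" using iff w(2) by auto
    next
      fix w assume "w \<in> (\<Union>n\<in>{j..}. {w \<in> D n. b n w \<in> E n j})"
      then show "w \<in> {w \<in> space M. a \<le> real (root_count (p w) K)}" using iff by (auto simp: j D_def)
    qed
    also have "\<dots> \<in> sets M"
    proof (intro sets.countable_UN'' countable_Collect)
      fix n assume n: "n \<in> {j..}"
      have [measurable]: "E n j \<in> sets borel"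
        unfolding E_def using coefficients_with_roots_in_closed_borel[OF K] n by auto
      have "{w \<in> D n. b n w \<in> E n j} = D n \<inter> {w \<in> space M. b n w \<in> E n j}" by (auto simp: D_def)
      also have "\<dots> \<in> sets M" by measurable
      finally show "{w \<in> D n. b n w \<in> E n j} \<in> sets M" .
    qed auto
    finally show ?thesis .
  qed
  then show ?thesis by (simp add: borel_measurable_iff_ge)
qed

lemma size_filter_mset_disjoint_Union_sums:
  fixes A :: "nat \<Rightarrow> 'a set"
  assumes A: "disjoint_family A"
  shows "(\<lambda>i. real (size {#z \<in># Z. z \<in> A i#})) sums real (size {#z \<in># Z. z \<in> (\<Union>i. A i)#})"
proof (induction Z)
  case empty
  then show ?case by simp
next
  case (add x Z)
  have ind: "(\<lambda>i. of_bool (x \<in> A i) :: real) sums of_bool (x \<in> (\<Union>i. A i))"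
  proof (cases "x \<in> (\<Union>i. A i)")
    case True
    then obtain i0 where "x \<in> A i0" by auto
    then have "x \<in> A i \<longleftrightarrow> i = i0" for i
      using A by (metis disjoint_family_onD disjoint_iff UNIV_I)
    then have "(\<lambda>i. of_bool (x \<in> A i) :: real) = (\<lambda>i. if i = i0 then 1 else 0)" by auto
    then show ?thesis using sums_single[of i0 "\<lambda>_. 1 :: real"] True by simp
  qed simp
  have eq: "real (size {#z \<in># add_mset x Z. z \<in> B#}) = of_bool (x \<in> B) + real (size {#z \<in># Z. z \<in> B#})" for B
    by simp
  show ?case unfolding eq by (rule sums_add[OF ind add.IH])
qed

text \<open>
  Closed sets are an intersection-stable generator of the Borel sets, and the count is additive, so the
  closed case extends by a Dynkin argument.
\<close>

lemma borel_measurable_root_count: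
  fixes p :: "'w \<Rightarrow> complex poly"
  assumes coeff: "\<And>k. (\<lambda>w. coeff (p w) k) \<in> borel_measurable M" and B: "B \<in> sets borel"
  shows "(\<lambda>w. real (root_count (p w) B)) \<in> borel_measurable M"
proof -
  have "Int_stable (Collect closed :: complex set set)" "Collect closed \<subseteq> Pow (UNIV :: complex set)"
    by (auto simp: Int_stable_def)
  moreover have "B \<in> sigma_sets UNIV (Collect closed)" using B by (simp add: borel_eq_closed)
  ultimately show ?thesis
  proof (induction rule: sigma_sets_induct_disjoint)
    case (basic K)
    then show ?case using borel_measurable_root_count_closed[OF coeff] by simp
  next
    case empty
    then show ?case by simp
  next
    case (compl A)
    have "real (root_count (p w) (UNIV - A)) = real (root_count (p w) UNIV) - real (root_count (p w) A)" for w
    proof -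
      have "size (proots (p w)) = root_count (p w) A + root_count (p w) (UNIV - A)"
        using multiset_partition[of "proots (p w)" "\<lambda>z. z \<in> A"] by (metis (no_types, lifting) Diff_iff UNIV_I filter_mset_cong size_union)
      then show ?thesis by simp
    qed
    then show ?case
      using compl.IH borel_measurable_root_count_closed[OF coeff closed_UNIV] by simp
  next
    case (union A)
    have "real (root_count (p w) (\<Union>i. A i)) = (\<Sum>i. real (root_count (p w) (A i)))" for w
      by (rule sums_unique[OF size_filter_mset_disjoint_Union_sums[OF union.hyps(1)]])
    then show ?case using union.IH by (simp add: borel_measurable_suminf del: Union_iff UN_iff)
  qed
qed

text \<open>
  The argument is continuous off the nonnegative real axis and constant on it.
\<close>

lemma borel_measurable_Arg2pi: "Arg2pi \<in> borel_measurable borel"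
proof -
  have "Arg2pi = (\<lambda>z. if z \<in> \<real>\<^sub>\<ge>\<^sub>0 then 0 else Arg2pi z)"
    by (auto simp: fun_eq_iff Arg2pi_eq_0 nonneg_Reals_def complex_is_Real_iff)
  moreover have "(\<lambda>z. if z \<in> \<real>\<^sub>\<ge>\<^sub>0 then 0 else Arg2pi z) \<in> borel_measurable borel"
    by (rule borel_measurable_continuous_on_if) (auto intro!: continuous_at_imp_continuous_on continuous_at_Arg2pi)
  ultimately show ?thesis by simp
qed

section \<open>Almost sure growth of the coefficients\<close>

lemma running_max_sublinear:
  fixes b :: "nat \<Rightarrow> real"
  assumes nonneg: "\<And>k. b k \<ge> 0" and lim: "(\<lambda>k. b k / k) \<longlonglongrightarrow> 0"
  shows "(\<lambda>N. Max (b ` {..N}) / N) \<longlonglongrightarrow> 0"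
proof (rule LIMSEQ_I)
  fix e :: real assume e: "e > 0"
  have "eventually (\<lambda>k. b k / k < e / 2) sequentially"
    using lim e by (intro order_tendstoD) auto
  then obtain K where K: "\<And>k. k \<ge> K \<Longrightarrow> b k / k < e / 2" by (auto simp: eventually_sequentially)
  define B where "B = Max (b ` {..K})"
  have B: "b k \<le> B" if "k \<le> K" for k unfolding B_def using that by auto
  have "B \<ge> 0" using B[of 0] nonneg[of 0] by simp
  have bound: "b k \<le> B + e / 2 * k" for k
  proof (cases "k \<le> K \<or> k = 0")
    case True
    then have "b k \<le> B" using B by auto
    moreover have "0 \<le> e / 2 * k" using e by simp
    ultimately show ?thesis by linarith
  next
    case False
    then have "b k < e / 2 * k" using K[of k] by (simp add: field_simps)
    then show ?thesis using \<open>B \<ge> 0\<close> by linarith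
  qed
  have "eventually (\<lambda>N. B / real N < e / 2) sequentially"
    by (rule order_tendstoD(2)[of _ 0]) (use e in real_asymp, use e in simp)
  then have "eventually (\<lambda>N. norm (Max (b ` {..N}) / N) < e) sequentially"
    using eventually_gt_at_top[of 0]
  proof eventually_elim
    case (elim N)
    have "Max (b ` {..N}) \<le> B + e / 2 * N"
    proof (intro Max.boundedI)
      fix x assume "x \<in> b ` {..N}"
      then obtain k where k: "k \<le> N" "x = b k" by auto
      have "e / 2 * k \<le> e / 2 * N" using k(1) e by (intro mult_left_mono) auto
      then show "x \<le> B + e / 2 * N" using bound[of k] k(2) by linarith
    qed auto
    moreover have "Max (b ` {..N}) \<ge> 0"
      using nonneg[of 0] by (subst Max_ge_iff) auto
    moreover have "B < e / 2 * N" using elim by (simp add: field_simps)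
    ultimately have "0 \<le> Max (b ` {..N})" "Max (b ` {..N}) < e * N" by linarith+
    then show ?case using elim(2) by (simp add: field_simps)
  qed
  then show "\<exists>n0. \<forall>N\<ge>n0. norm (Max (b ` {..N}) / N - 0) < e"
    by (simp add: eventually_sequentially)
qed

text \<open>
  The summand 1 makes the logarithm nonnegative. It is needed because the \<open>k\<close>-th roots are bounded only
  from above.
\<close>

lemma ln_one_plus_sublinear:
  fixes L :: "nat \<Rightarrow> real"
  assumes nonneg: "\<And>k. L k \<ge> 0" and lim: "limsup (\<lambda>k. ereal (root k (L k))) \<le> 1"
  shows "(\<lambda>k. ln (1 + L k) / k) \<longlonglongrightarrow> 0"
proof (rule LIMSEQ_I)
  fix e :: real assume e: "e > 0"
  have "limsup (\<lambda>k. ereal (root k (L k))) < ereal (exp (e / 2))"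
    using e by (intro le_less_trans[OF lim]) (simp add: one_ereal_def)
  then have "eventually (\<lambda>k. ereal (root k (L k)) < ereal (exp (e / 2))) sequentially"
    by (rule Limsup_lessD)
  moreover have "eventually (\<lambda>k. ln 2 / real k < e / 2) sequentially"
    by (rule order_tendstoD(2)[of _ 0]) (real_asymp, use e in simp)
  ultimately have "eventually (\<lambda>k. norm (ln (1 + L k) / k) < e) sequentially"
    using eventually_gt_at_top[of 0]
  proof eventually_elim
    case (elim k)
    have "L k = root k (L k) ^ k" using elim nonneg by simp
    also have "\<dots> \<le> exp (e / 2) ^ k" using elim nonneg by (intro power_mono) auto
    also have "\<dots> = exp (e / 2 * k)" using exp_of_nat_mult[of k "e / 2"] by (simp add: mult.commute)
    finally have "L k \<le> exp (e / 2 * k)" .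
    moreover have "1 \<le> exp (e / 2 * k)" using e by simp
    ultimately have "1 + L k \<le> 2 * exp (e / 2 * k)" by linarith
    then have "ln (1 + L k) \<le> ln (2 * exp (e / 2 * k))"
      using nonneg[of k] by (subst ln_le_cancel_iff) auto
    also have "\<dots> = ln 2 + e / 2 * k" by (simp add: ln_mult)
    also have "ln 2 < e / 2 * k" using elim by (simp add: field_simps)
    finally have "ln (1 + L k) < e * k" by simp
    moreover have "ln (1 + L k) \<ge> 0" using nonneg[of k] by simp
    ultimately show ?case using elim by (simp add: field_simps)
  qed
  then show "\<exists>n0. \<forall>k\<ge>n0. norm (ln (1 + L k) / k - 0) < e"
    by (simp add: eventually_sequentially)
qed

text \<open>
  Dividing \<open>Y\<^sub>k\<close> by \<open>exp (b k) = (1 + E Y\<^sub>k) (k + 1)\<^sup>2\<close> makes the sum of expectations converge, so almost surely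
  the weighted series is finite and its value bounds every term. The running maximum turns \<open>b\<close> into
  a monotone rate, which then bounds all coefficients up to index \<open>N\<close> at once.
\<close>

lemma AE_growth_of_moments:
  fixes Y :: "nat \<Rightarrow> 'w \<Rightarrow> ennreal"
  assumes meas [measurable]: "\<And>k. Y k \<in> borel_measurable M"
    and fin: "\<And>k. (\<integral>\<^sup>+ w. Y k w \<partial>M) < \<infinity>"
    and lim: "limsup (\<lambda>k. ereal (root k (enn2real (\<integral>\<^sup>+ w. Y k w \<partial>M)))) \<le> 1"
  obtains \<beta> :: "nat \<Rightarrow> real" where "mono \<beta>" "\<And>k. \<beta> k \<ge> 0" "(\<lambda>k. \<beta> k / k) \<longlonglongrightarrow> 0"
    "AE w in M. \<exists>K. \<forall>k. Y k w \<le> ennreal (exp (K + \<beta> k))"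
proof -
  define L where "L = (\<lambda>k. enn2real (\<integral>\<^sup>+ w. Y k w \<partial>M))"
  define b where "b = (\<lambda>k. ln (1 + L k) + 2 * ln (real k + 1))"
  define \<beta> where "\<beta> = (\<lambda>N. Max (b ` {..N}))"
  have L: "L k \<ge> 0" "(\<integral>\<^sup>+ w. Y k w \<partial>M) = ennreal (L k)" for k
    using fin[of k] by (simp_all add: L_def less_top)
  have b: "b k \<ge> 0" for k using L(1)[of k] by (simp add: b_def)
  have "(\<lambda>k. ln (1 + L k) / k) \<longlonglongrightarrow> 0"
    by (rule ln_one_plus_sublinear[OF L(1)]) (use lim in \<open>simp only: L_def\<close>)
  moreover have "(\<lambda>k. 2 * ln (real k + 1) / k) \<longlonglongrightarrow> 0" by real_asymp
  ultimately have "(\<lambda>k. b k / k) \<longlonglongrightarrow> 0"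
    unfolding b_def add_divide_distrib by (auto intro: tendsto_add_zero)
  then have lim\<beta>: "(\<lambda>k. \<beta> k / k) \<longlonglongrightarrow> 0"
    unfolding \<beta>_def by (intro running_max_sublinear b)
  have b\<beta>: "b k \<le> \<beta> k" for k by (simp add: \<beta>_def)
  have \<beta>: "\<beta> k \<ge> 0" for k using b b\<beta> order_trans by blast
  have "mono \<beta>" unfolding \<beta>_def by (intro monoI Max_mono) auto
  define S where "S = (\<lambda>w. \<Sum>k. ennreal (exp (- b k)) * Y k w)"
  have [measurable]: "S \<in> borel_measurable M" unfolding S_def by measurable
  have "(\<integral>\<^sup>+ w. S w \<partial>M) = (\<Sum>k. ennreal (exp (- b k) * L k))"
    unfolding S_def by (simp add: nn_integral_suminf nn_integral_cmult L ennreal_mult)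
  also have "\<dots> \<le> (\<Sum>k. ennreal (inverse (real (Suc k) ^ 2)))"
  proof (intro suminf_le ennreal_leI summableI)
    fix k
    have "exp (- b k) = inverse (1 + L k) * inverse (real (Suc k) ^ 2)"
    proof -
      have "exp (2 * ln (real k + 1)) = real (Suc k) ^ 2" by (simp add: exp_double add.commute)
      then show ?thesis unfolding b_def exp_minus exp_add using L(1)[of k] by simp
    qed
    then have "exp (- b k) * L k = (L k / (1 + L k)) * inverse (real (Suc k) ^ 2)"
      by (simp add: field_simps)
    also have "\<dots> \<le> 1 * inverse (real (Suc k) ^ 2)"
      using L(1)[of k] by (intro mult_right_mono) auto
    finally show "exp (- b k) * L k \<le> inverse (real (Suc k) ^ 2)" by simp
  qed
  also have "\<dots> < \<infinity>"
  proof -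
    have "summable (\<lambda>k. inverse (real (Suc k) ^ 2))"
      using inverse_power_summable[of 2, where 'a = real] by (subst summable_Suc_iff) simp
    then show ?thesis by (simp add: suminf_ennreal2)
  qed
  finally have "AE w in M. S w \<noteq> \<infinity>" by (intro nn_integral_noteq_infinite) auto
  then have "AE w in M. \<exists>K. \<forall>k. Y k w \<le> ennreal (exp (K + \<beta> k))"
  proof eventually_elim
    case (elim w)
    define C where "C = enn2real (S w)"
    have C: "S w = ennreal C" "C \<ge> 0" using elim by (simp_all add: C_def less_top)
    have "Y k w \<le> ennreal (exp (ln (1 + C) + \<beta> k))" for k
    proof -
      have "ennreal (exp (- b k)) * Y k w \<le> S w"
        unfolding S_def using sum_le_suminf[OF summableI, of "{k}" "\<lambda>k. ennreal (exp (- b k)) * Y k w"] by simp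
      then have "ennreal (exp (b k)) * (ennreal (exp (- b k)) * Y k w) \<le> ennreal (exp (b k)) * ennreal C"
        unfolding C(1) by (rule mult_left_mono) simp
      then have "Y k w \<le> ennreal (exp (b k) * C)"
        using C(2) by (simp add: mult.assoc[symmetric] ennreal_mult[symmetric] exp_add[symmetric])
      also have "exp (b k) * C \<le> exp (\<beta> k) * (1 + C)"
        using b\<beta>[of k] C(2) by (intro mult_mono) auto
      also have "\<dots> = exp (ln (1 + C) + \<beta> k)" using C(2) by (simp add: exp_add)
      finally show ?thesis by (simp add: ennreal_leI)
    qed
    then show ?case by blast
  qed
  then show ?thesis using that \<open>mono \<beta>\<close> \<beta> lim\<beta> by blast
qed

text \<open>
  Taking logarithms of the growth bounds: the upper one controls the sum of the \<open>|a\<^sub>k|\<close>, the lower one the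
  two extreme coefficients. The summand 1 in \<open>D\<close> makes \<open>D \<ge> 1\<close>, so that a random constant can be absorbed
  into a multiple of \<open>D\<close>.
\<close>

lemma AE_root_energy_sublinear:
  fixes a :: "nat \<Rightarrow> 'w \<Rightarrow> complex"
  assumes [measurable]: "\<And>k. a k \<in> borel_measurable M"
    and up: "s > 0" "\<And>k. abs_moment M (a k) s < \<infinity>"
      "limsup (\<lambda>k. ereal (root k (enn2real (abs_moment M (a k) s)))) \<le> 1"
    and low: "t > 0" "\<And>k. inv_abs_moment M (a k) t < \<infinity>"
      "limsup (\<lambda>k. ereal (root k (enn2real (inv_abs_moment M (a k) t)))) \<le> 1"
  obtains D :: "nat \<Rightarrow> real" where "\<And>N. D N \<ge> 1" "(\<lambda>N. D N / N) \<longlonglongrightarrow> 0"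
    "AE w in M. (\<forall>k. a k w \<noteq> 0) \<and> (\<exists>K. \<forall>N. root_energy (rand_poly a N w) \<le> K + D N)"
proof -
  obtain \<beta> where \<beta>: "mono \<beta>" "\<And>k. \<beta> k \<ge> 0" "(\<lambda>k. \<beta> k / k) \<longlonglongrightarrow> 0"
    and upper: "AE w in M. \<exists>K. \<forall>k. ennreal (norm (a k w) powr s) \<le> ennreal (exp (K + \<beta> k))"
    by (rule AE_growth_of_moments[of "\<lambda>k w. ennreal (norm (a k w) powr s)" M])
      (use up in \<open>auto simp: abs_moment_def\<close>)
  obtain \<gamma> where \<gamma>: "mono \<gamma>" "\<And>k. \<gamma> k \<ge> 0" "(\<lambda>k. \<gamma> k / k) \<longlonglongrightarrow> 0"
    and lower: "AE w in M. \<exists>K. \<forall>k. 1 / ennreal (norm (a k w) powr t) \<le> ennreal (exp (K + \<gamma> k))"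
    by (rule AE_growth_of_moments[of "\<lambda>k w. 1 / ennreal (norm (a k w) powr t)" M])
      (use low in \<open>auto simp: inv_abs_moment_def\<close>)
  define D where "D = (\<lambda>N. 1 + 2 * ln (real N + 1) + 2 * (\<beta> N / s) + 2 * (\<gamma> N / t))"
  have D1: "D N \<ge> 1" for N
    using \<beta>(2)[of N] \<gamma>(2)[of N] up(1) low(1) by (simp add: D_def)
  have "(\<lambda>N. (1 + 2 * ln (real N + 1)) / N + 2 / s * (\<beta> N / N) + 2 / t * (\<gamma> N / N)) \<longlonglongrightarrow> 0"
    by (intro tendsto_add_zero tendsto_mult_right_zero \<beta> \<gamma>) real_asymp
  then have limD: "(\<lambda>N. D N / N) \<longlonglongrightarrow> 0"
    by (simp add: D_def add_divide_distrib mult_ac)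
  have "AE w in M. (\<forall>k. a k w \<noteq> 0) \<and> (\<exists>K. \<forall>N. root_energy (rand_poly a N w) \<le> K + D N)"
    using upper lower
  proof eventually_elim
    case (elim w)
    obtain K where K: "\<And>k. ennreal (norm (a k w) powr s) \<le> ennreal (exp (K + \<beta> k))" using elim(1) by blast
    obtain J where J: "\<And>k. 1 / ennreal (norm (a k w) powr t) \<le> ennreal (exp (J + \<gamma> k))" using elim(2) by blast
    have nz: "a k w \<noteq> 0" for k
    proof
      assume "a k w = 0"
      \<comment> \<open>At a zero of \<open>a k\<close> the reciprocal is infinite, but the bound is finite.\<close>
      then show False using J[of k] by (simp add: top_unique)
    qed
    have lnu: "ln (norm (a k w)) \<le> (K + \<beta> k) / s" for k
    proof -
      have "norm (a k w) powr s \<le> exp (K + \<beta> k)" using K[of k] by simp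
      then have "exp (s * ln (norm (a k w))) \<le> exp (K + \<beta> k)" using nz by (simp add: powr_def)
      then show ?thesis using up(1) by (simp add: field_simps)
    qed
    have lnl: "- ln (norm (a k w)) \<le> (J + \<gamma> k) / t" for k
    proof -
      have "1 / norm (a k w) powr t \<le> exp (J + \<gamma> k)"
        using J[of k] nz[of k] by (simp add: divide_ennreal flip: ennreal_1)
      then have "exp (- (t * ln (norm (a k w)))) \<le> exp (J + \<gamma> k)" using nz by (simp add: powr_def exp_minus field_simps)
      then show ?thesis using low(1) by (simp add: field_simps)
    qed
    have "root_energy (rand_poly a N w) \<le> (2 * (K / s) + 2 * (J / t)) + D N" for N
    proof -
      have co: "coeff (rand_poly a N w) k = (if k \<le> N then a k w else 0)" for k
        by (simp add: rand_poly_def coeff_sum)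
      have deg: "degree (rand_poly a N w) = N"
        using nz by (intro antisym degree_le le_degree) (auto simp: co)
      define S where "S = (\<Sum>k\<le>N. norm (a k w))"
      have "norm (a k w) \<le> exp ((K + \<beta> N) / s)" if "k \<le> N" for k
      proof -
        have "ln (norm (a k w)) \<le> (K + \<beta> N) / s"
          using lnu[of k] monoD[OF \<beta>(1) that] up(1) by (smt (verit) divide_right_mono)
        then show ?thesis using nz[of k] by (metis exp_ln exp_le_cancel_iff zero_less_norm_iff)
      qed
      then have "S \<le> (\<Sum>k\<le>N. exp ((K + \<beta> N) / s))" unfolding S_def by (intro sum_mono) auto
      then have "S \<le> (real N + 1) * exp ((K + \<beta> N) / s)" by (simp add: algebra_simps)
      moreover have "S > 0" unfolding S_def using nz by (intro sum_pos) auto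
      ultimately have "ln S \<le> ln ((real N + 1) * exp ((K + \<beta> N) / s))" by (subst ln_le_cancel_iff) auto
      then have lnS: "ln S \<le> ln (real N + 1) + (K + \<beta> N) / s" by (simp add: ln_mult)
      have "root_energy (rand_poly a N w) = 2 * ln S - ln (norm (a 0 w)) - ln (norm (a N w))"
        unfolding root_energy_def deg co using nz \<open>S > 0\<close>
        by (simp add: S_def[symmetric] ln_div ln_mult ln_realpow)
      also have "\<dots> \<le> 2 * (ln (real N + 1) + (K + \<beta> N) / s) + (J + \<gamma> N) / t + (J + \<gamma> N) / t"
      proof -
        have "(J + \<gamma> 0) / t \<le> (J + \<gamma> N) / t"
          using monoD[OF \<gamma>(1), of 0 N] low(1) by (intro divide_right_mono) auto
        then show ?thesis using lnS lnl[of 0] lnl[of N] by argo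
      qed
      also have "\<dots> \<le> (2 * (K / s) + 2 * (J / t)) + D N"
        unfolding D_def by (simp add: add_divide_distrib)
      finally show ?thesis .
    qed
    then show ?case using nz by blast
  qed
  then show ?thesis using that D1 limD by blast
qed

section \<open>Zeros in annuli and sectors\<close>

lemma nonzero_root_enumeration:
  fixes p :: "complex poly"
  assumes p0: "coeff p 0 \<noteq> 0"
  obtains z where "p = smult (lead_coeff p) (\<Prod>i<degree p. [:- z i, 1:])"
    "proots p = image_mset z (mset_set {..<degree p})" "\<And>i. i < degree p \<Longrightarrow> z i \<noteq> 0"
proof -
  have "p \<noteq> 0" using p0 by auto
  obtain z where z: "smult (lead_coeff p) (\<Prod>i<degree p. [:- z i, 1:]) = p"
    by (rule complex_poly_decompose')
  have "proots (smult (lead_coeff p) (\<Prod>i<degree p. [:- z i, 1:])) = proots (\<Prod>i<degree p. [:- z i, 1:])"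
    using \<open>p \<noteq> 0\<close> by (intro proots_smult) simp
  also have "\<dots> = image_mset z (mset_set {..<degree p})"
    by (subst proots_prod) (auto simp: sum_unfold_sum_mset)
  finally have roots: "proots p = image_mset z (mset_set {..<degree p})" unfolding z .
  have "z i \<noteq> 0" if "i < degree p" for i
  proof
    assume "z i = 0"
    moreover have "z i \<in># proots p" using roots that by auto
    ultimately have "poly p 0 = 0" using \<open>p \<noteq> 0\<close> by simp
    then show False using p0 by (simp add: poly_0_coeff_0)
  qed
  then show ?thesis using that z roots by metis
qed

text \<open>
  A root outside the annulus has \<open>|ln |z|| \<ge> - ln (1 - \<rho>) \<ge> \<rho>\<close>, and these terms sum to at most the energy.
\<close>

lemma zeros_outside_annulus_le:
  assumes p0: "coeff p 0 \<noteq> 0" and \<rho>: "0 < \<rho>" "\<rho> \<le> 1"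
  shows "(real (degree p) - real (zeros_annulus p \<rho>)) * \<rho> \<le> root_energy p"
proof -
  obtain z where p: "p = smult (lead_coeff p) (\<Prod>i<degree p. [:- z i, 1:])"
    and roots: "proots p = image_mset z (mset_set {..<degree p})"
    and z: "\<And>i. i < degree p \<Longrightarrow> z i \<noteq> 0"
    using nonzero_root_enumeration[OF p0] by blast
  have lead: "lead_coeff p \<noteq> 0" using p0 by auto
  define In where "In = (\<lambda>w :: complex. 1 - \<rho> \<le> norm w \<and> (\<rho> = 1 \<or> norm w \<le> 1 / (1 - \<rho>)))"
  define A where "A = {i. i < degree p \<and> In (z i)}"
  define B where "B = {i. i < degree p \<and> \<not> In (z i)}"
  have A: "zeros_annulus p \<rho> = card A"
    unfolding zeros_annulus_def roots A_def In_def[symmetric] by (rule size_filter_image_lessThan)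
  have "card A + card B = card (A \<union> B)"
    by (intro card_Un_disjoint[symmetric]) (auto simp: A_def B_def)
  also have "A \<union> B = {..<degree p}" by (auto simp: A_def B_def)
  finally have card: "real (degree p) - real (card A) = real (card B)" by simp
  have large: "\<rho> \<le> \<bar>ln (norm (z i))\<bar>" if i: "i \<in> B" for i
  proof -
    have zi: "norm (z i) > 0" "\<not> In (z i)" using i z by (auto simp: B_def)
    show ?thesis
    proof (cases "\<rho> = 1")
      case True
      then show ?thesis using zi by (simp add: In_def)
    next
      case False
      then have pos: "1 - \<rho> > 0" using \<rho> by simp
      have le: "ln (1 - \<rho>) \<le> - \<rho>" using ln_add_one_self_le_self2[of "- \<rho>"] pos by simp
      consider "norm (z i) < 1 - \<rho>" | "norm (z i) > 1 / (1 - \<rho>)"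
        using zi False by (auto simp: In_def)
      then show ?thesis
      proof cases
        case 1
        then have "ln (norm (z i)) \<le> ln (1 - \<rho>)" using zi pos by (subst ln_le_cancel_iff) auto
        then show ?thesis using le by linarith
      next
        case 2
        then have "ln (1 / (1 - \<rho>)) \<le> ln (norm (z i))" using zi pos by (subst ln_le_cancel_iff) auto
        then show ?thesis using le pos by (simp add: ln_div)
      qed
    qed
  qed
  have "real (card B) * \<rho> = (\<Sum>i\<in>B. \<rho>)" by simp
  also have "\<dots> \<le> (\<Sum>i\<in>B. \<bar>ln (norm (z i))\<bar>)" by (intro sum_mono large)
  also have "\<dots> \<le> (\<Sum>i<degree p. \<bar>ln (norm (z i))\<bar>)" by (intro sum_mono2) (auto simp: B_def)
  also have "\<dots> \<le> root_energy p" by (rule root_sums_le_energy(1)[OF p lead z])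
  finally show ?thesis unfolding A card .
qed

lemma zeros_annulus_le_degree: "zeros_annulus p \<rho> \<le> degree p"
  unfolding zeros_annulus_def by (rule order_trans[OF size_filter_mset_lesseq size_proots_le])

lemma zeros_sector_le_degree: "zeros_sector p \<theta> \<phi> \<le> degree p"
  unfolding zeros_sector_def by (rule order_trans[OF size_filter_mset_lesseq size_proots_le])

lemma sgn_eq_cis_Arg2pi: "z \<noteq> 0 \<Longrightarrow> sgn z = cis (Arg2pi z)"
  using Arg2pi_eq[of z] by (simp add: sgn_eq cis_conv_exp field_simps)

text \<open>
  The exponential sums of the arguments are the power sums of the normalised roots, which are bounded
  by \<open>m\<close> times the energy.
\<close>

lemma zeros_sector_equidistributed:
  fixes P :: "nat \<Rightarrow> complex poly"
  assumes P: "\<And>N. degree (P N) = N" "\<And>N. coeff (P N) 0 \<noteq> 0"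
    and energy: "(\<lambda>N. root_energy (P N) / N) \<longlonglongrightarrow> 0"
    and \<theta>\<phi>: "0 \<le> \<theta>" "\<theta> < \<phi>" "\<phi> \<le> 2 * pi"
  shows "(\<lambda>N. real (zeros_sector (P N) \<theta> \<phi>) / N) \<longlonglongrightarrow> (\<phi> - \<theta>) / (2 * pi)"
proof -
  have "\<exists>z. P N = smult (lead_coeff (P N)) (\<Prod>i<N. [:- z i, 1:]) \<and>
      proots (P N) = image_mset z (mset_set {..<N}) \<and> (\<forall>i<N. z i \<noteq> 0)" for N
    using nonzero_root_enumeration[OF P(2)[of N]] unfolding P(1) by metis
  then obtain z where z: "\<And>N. P N = smult (lead_coeff (P N)) (\<Prod>i<N. [:- z N i, 1:])"
    "\<And>N. proots (P N) = image_mset (z N) (mset_set {..<N})" "\<And>N i. i < N \<Longrightarrow> z N i \<noteq> 0"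
    by metis
  define x where "x = (\<lambda>N i. Arg2pi (z N i))"
  have lead: "lead_coeff (P N) \<noteq> 0" for N using P(2)[of N] by auto
  have "exp_sums_vanish x"
    unfolding exp_sums_vanish_def
  proof (intro allI impI)
    fix m :: nat assume m: "m \<ge> 1"
    have le: "norm ((\<Sum>i<N. cis (of_nat m * x N i)) / of_nat N) \<le> m * (root_energy (P N) / N)" for N
    proof -
      have "(\<Sum>i<N. cis (of_nat m * x N i)) = (\<Sum>i<N. sgn (z N i) ^ m)"
      proof (intro sum.cong refl)
        fix i assume "i \<in> {..<N}"
        then have "sgn (z N i) = cis (x N i)" unfolding x_def using z(3) by (intro sgn_eq_cis_Arg2pi) simp
        then show "cis (of_nat m * x N i) = sgn (z N i) ^ m" by (simp only: Complex.DeMoivre)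
      qed
      also have "norm \<dots> \<le> m * root_energy (P N)"
        using root_sums_le_energy(2)[OF z(1) lead z(3) m] by simp
      finally show ?thesis by (simp add: norm_divide divide_right_mono)
    qed
    show "(\<lambda>N. (\<Sum>i<N. cis (of_nat m * x N i)) / of_nat N) \<longlonglongrightarrow> 0"
      by (rule Lim_null_comparison[OF always_eventually[OF allI[OF le]] tendsto_mult_right_zero[OF energy]])
  qed
  then have "(\<lambda>N. card {i. i < N \<and> \<theta> \<le> x N i \<and> x N i < \<phi>} / N) \<longlonglongrightarrow> (\<phi> - \<theta>) / (2 * pi)"
    by (rule weyl_equidistribution) (use \<theta>\<phi> Arg2pi_ge_0 Arg2pi_lt_2pi in \<open>auto simp: x_def\<close>)
  moreover have "zeros_sector (P N) \<theta> \<phi> = card {i. i < N \<and> \<theta> \<le> x N i \<and> x N i < \<phi>}" for N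
    unfolding zeros_sector_def z(2) x_def by (rule size_filter_image_lessThan)
  ultimately show ?thesis by simp
qed

lemma (in prob_space) converges_in_mean_if_bounded:
  assumes meas [measurable]: "\<And>N. X N \<in> borel_measurable M"
    and X: "\<And>N w. w \<in> space M \<Longrightarrow> 0 \<le> X N w \<and> X N w \<le> 1" and c: "0 \<le> c" "c \<le> 1"
    and lim: "AE w in M. (\<lambda>N. X N w) \<longlonglongrightarrow> c" and p: "p > 0"
  shows "converges_in_mean M p X (\<lambda>_. c)"
proof -
  have le: "\<bar>X N w - c\<bar> powr p \<le> 1" if "w \<in> space M" for N w
    using X[OF that, of N] c p by (intro powr_le1) auto
  have int: "integrable M (\<lambda>w. \<bar>X N w - c\<bar> powr p)" for N
    by (rule integrable_const_bound[where B = 1]) (use le in auto)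
  have "(\<lambda>N. \<integral>w. \<bar>X N w - c\<bar> powr p \<partial>M) \<longlonglongrightarrow> (\<integral>w. 0 \<partial>M)"
  proof (rule integral_dominated_convergence[where w = "\<lambda>_. 1"])
    show "AE w in M. (\<lambda>N. \<bar>X N w - c\<bar> powr p) \<longlonglongrightarrow> 0"
      using lim
    proof eventually_elim
      case (elim w)
      then have "(\<lambda>N. \<bar>X N w - c\<bar>) \<longlonglongrightarrow> 0" using LIM_zero tendsto_rabs_zero by blast
      then show ?case using p by (intro tendsto_zero_powrI[where b = p]) auto
    qed
  qed (use le in auto)
  then show ?thesis using int by (simp add: converges_in_mean_def)
qed

theorem theorem7:
  fixes M :: "'w measure" and a :: "nat \<Rightarrow> 'w \<Rightarrow> complex"
  assumes "prob_space M"
    and "\<And>k. a k \<in> borel_measurable M"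
    and "\<exists>s>0. (\<forall>k. abs_moment M (a k) s < \<infinity>) \<and>
           limsup (\<lambda>k. ereal (root k (enn2real (abs_moment M (a k) s)))) = 1"
    and "\<exists>t>0. (\<forall>k. inv_abs_moment M (a k) t < \<infinity>) \<and>
           limsup (\<lambda>k. ereal (root k (enn2real (inv_abs_moment M (a k) t)))) = 1"
  shows "\<exists>\<alpha> :: nat \<Rightarrow> real.
      (\<forall>N\<ge>1. 0 < \<alpha> N \<and> \<alpha> N \<le> real N) \<and>
      \<alpha> \<in> o(\<lambda>N. real N) \<and>
      (AE w in M. (\<lambda>N. real (zeros_annulus (rand_poly a N w) (\<alpha> N / real N)) / real N)
                    \<longlonglongrightarrow> 1) \<and>
      (\<forall>\<theta> \<phi>. 0 \<le> \<theta> \<and> \<theta> < \<phi> \<and> \<phi> \<le> 2 * pi \<longrightarrow>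
         (AE w in M. (\<lambda>N. real (zeros_sector (rand_poly a N w) \<theta> \<phi>) / real N)
                       \<longlonglongrightarrow> (\<phi> - \<theta>) / (2 * pi))) \<and>
      (\<forall>p>0. converges_in_mean M p
         (\<lambda>N w. real (zeros_annulus (rand_poly a N w) (\<alpha> N / real N)) / real N) (\<lambda>w. 1)) \<and>
      (\<forall>p>0. \<forall>\<theta> \<phi>. 0 \<le> \<theta> \<and> \<theta> < \<phi> \<and> \<phi> \<le> 2 * pi \<longrightarrow>
         converges_in_mean M p
           (\<lambda>N w. real (zeros_sector (rand_poly a N w) \<theta> \<phi>) / real N)
           (\<lambda>w. (\<phi> - \<theta>) / (2 * pi)))"
proof -
  interpret prob_space M by fact
  note [measurable] = assms(2)
  obtain s where s: "s > 0" "\<And>k. abs_moment M (a k) s < \<infinity>"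
    "limsup (\<lambda>k. ereal (root k (enn2real (abs_moment M (a k) s)))) = 1" using assms(3) by blast
  obtain t where t: "t > 0" "\<And>k. inv_abs_moment M (a k) t < \<infinity>"
    "limsup (\<lambda>k. ereal (root k (enn2real (inv_abs_moment M (a k) t)))) = 1" using assms(4) by blast
  obtain D where D: "\<And>N. D N \<ge> 1" "(\<lambda>N. D N / real N) \<longlonglongrightarrow> 0"
    and AE_D: "AE w in M. (\<forall>k. a k w \<noteq> 0) \<and> (\<exists>K. \<forall>N. root_energy (rand_poly a N w) \<le> K + D N)"
    using AE_root_energy_sublinear[OF assms(2) s(1,2) eq_refl[OF s(3)] t(1,2) eq_refl[OF t(3)]] by blast
  \<comment> \<open>The geometric mean of \<open>N\<close> and \<open>D N\<close> is far below \<open>N\<close> and far above \<open>D N\<close>. The cap at \<open>N\<close>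
    matters for finitely many \<open>N\<close> only.\<close>
  define \<alpha> where "\<alpha> = (\<lambda>N. min (real N) (sqrt (real N * D N)))"
  have Dpos: "D N > 0" for N using D(1)[of N] by linarith
  have \<alpha>: "0 < \<alpha> N \<and> \<alpha> N \<le> real N" if "N \<ge> 1" for N
    using that Dpos[of N] by (simp add: \<alpha>_def)
  have sqrt_ratio: "(\<lambda>N. sqrt (D N / real N)) \<longlonglongrightarrow> 0"
    using tendsto_real_sqrt[OF D(2)] by simp
  have "(\<lambda>N. \<alpha> N / real N) \<longlonglongrightarrow> 0"
  proof (rule tendsto_sandwich[OF _ _ tendsto_const sqrt_ratio])
    show "eventually (\<lambda>N. 0 \<le> \<alpha> N / real N) sequentially"
      using Dpos by (intro always_eventually) (auto simp: \<alpha>_def less_imp_le)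
    show "eventually (\<lambda>N. \<alpha> N / real N \<le> sqrt (D N / real N)) sequentially"
      using eventually_gt_at_top[of 0]
    proof eventually_elim
      case (elim N)
      have "\<alpha> N / real N \<le> sqrt (real N * D N) / sqrt (real N * real N)"
        using elim by (auto simp: \<alpha>_def intro!: divide_right_mono)
      also have "\<dots> = sqrt (D N / real N)" unfolding real_sqrt_divide[symmetric] using elim by simp
      finally show ?case .
    qed
  qed
  then have \<alpha>_small: "\<alpha> \<in> o(\<lambda>N. real N)"
    by (intro smalloI_tendsto eventually_mono[OF eventually_gt_at_top[of 0]]) auto
  have co: "coeff (rand_poly a N w) k = (if k \<le> N then a k w else 0)" for N w k
    by (simp add: rand_poly_def coeff_sum)
  have deg_le: "degree (rand_poly a N w) \<le> N" for N w
    by (intro degree_le) (simp add: co)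
  have AE_lim: "AE w in M. (\<lambda>N. real (zeros_annulus (rand_poly a N w) (\<alpha> N / real N)) / real N) \<longlonglongrightarrow> 1 \<and>
      (\<forall>\<theta> \<phi>. 0 \<le> \<theta> \<and> \<theta> < \<phi> \<and> \<phi> \<le> 2 * pi \<longrightarrow>
        (\<lambda>N. real (zeros_sector (rand_poly a N w) \<theta> \<phi>) / real N) \<longlonglongrightarrow> (\<phi> - \<theta>) / (2 * pi))"
    using AE_D
  proof eventually_elim
    case (elim w)
    define P where "P = (\<lambda>N. rand_poly a N w)"
    obtain K where nz: "\<And>k. a k w \<noteq> 0" and K: "\<And>N. root_energy (P N) \<le> K + D N"
      using elim by (auto simp: P_def)
    have deg: "degree (P N) = N" for N
      unfolding P_def using deg_le nz by (intro antisym le_degree) (auto simp: co)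
    have P0: "coeff (P N) 0 \<noteq> 0" for N using nz by (simp add: P_def co)
    have energy: "root_energy (P N) \<le> (\<bar>K\<bar> + 1) * D N" for N
    proof -
      have "\<bar>K\<bar> * 1 \<le> \<bar>K\<bar> * D N" by (intro mult_left_mono D) auto
      then show ?thesis using K[of N] by (simp add: algebra_simps)
    qed
    \<comment> \<open>The annulus with \<open>\<rho> = 1\<close> is the whole plane, so the bound on outside roots reads \<open>0 \<le> E\<close>.\<close>
    have energy_nonneg: "root_energy (P N) \<ge> 0" for N
    proof -
      have "(real (degree (P N)) - real (zeros_annulus (P N) 1)) * 1 \<le> root_energy (P N)"
        by (rule zeros_outside_annulus_le[OF P0]) auto
      moreover have "real (zeros_annulus (P N) 1) \<le> real (degree (P N))"
        using zeros_annulus_le_degree by simp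
      ultimately show ?thesis by argo
    qed
    have "(\<lambda>N. root_energy (P N) / real N) \<longlonglongrightarrow> 0"
    proof (rule tendsto_sandwich[OF _ _ tendsto_const tendsto_mult_right_zero[OF D(2), of "\<bar>K\<bar> + 1"]])
      show "eventually (\<lambda>N. 0 \<le> root_energy (P N) / real N) sequentially"
        using energy_nonneg by simp
      show "eventually (\<lambda>N. root_energy (P N) / real N \<le> (\<bar>K\<bar> + 1) * (D N / real N)) sequentially"
        using divide_right_mono[OF energy] by simp
    qed
    then have sector: "(\<lambda>N. real (zeros_sector (P N) \<theta> \<phi>) / real N) \<longlonglongrightarrow> (\<phi> - \<theta>) / (2 * pi)"
      if "0 \<le> \<theta>" "\<theta> < \<phi>" "\<phi> \<le> 2 * pi" for \<theta> \<phi>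
      using zeros_sector_equidistributed[OF deg P0 _ that] by blast
    have annulus: "(\<lambda>N. real (zeros_annulus (P N) (\<alpha> N / real N)) / real N) \<longlonglongrightarrow> 1"
    proof (rule tendsto_sandwich[OF _ _ _ tendsto_const])
      show "(\<lambda>N. 1 - (\<bar>K\<bar> + 1) * sqrt (D N / real N)) \<longlonglongrightarrow> 1"
        using tendsto_diff[OF tendsto_const tendsto_mult_right_zero[OF sqrt_ratio]] by simp
      show "eventually (\<lambda>N. real (zeros_annulus (P N) (\<alpha> N / real N)) / real N \<le> 1) sequentially"
        using eventually_gt_at_top[of 0]
      proof eventually_elim
        case (elim N)
        then show ?case using zeros_annulus_le_degree[of "P N" "\<alpha> N / real N"] deg[of N] by simp
      qed
      have "eventually (\<lambda>N. D N / real N < 1) sequentially"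
        using D(2) by (rule order_tendstoD) simp
      then show "eventually (\<lambda>N. 1 - (\<bar>K\<bar> + 1) * sqrt (D N / real N)
          \<le> real (zeros_annulus (P N) (\<alpha> N / real N)) / real N) sequentially"
        using eventually_gt_at_top[of 0]
      proof eventually_elim
        case (elim N)
        define \<nu> where "\<nu> = real (zeros_annulus (P N) (\<alpha> N / real N))"
        have "sqrt (real N * D N) \<le> sqrt (real N * real N)"
          using elim by (intro real_sqrt_le_mono mult_left_mono) (auto simp: field_simps)
        then have \<alpha>_eq: "\<alpha> N = sqrt (real N * D N)" by (simp add: \<alpha>_def)
        have \<alpha>pos: "\<alpha> N > 0" "\<alpha> N \<le> real N" using \<alpha>[of N] elim by auto
        have "(real N - \<nu>) * (\<alpha> N / real N) \<le> root_energy (P N)"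
          using zeros_outside_annulus_le[OF P0[of N], of "\<alpha> N / real N"] \<alpha>pos elim deg[of N]
          by (simp add: \<nu>_def)
        also have "\<dots> \<le> (\<bar>K\<bar> + 1) * D N" by (rule energy)
        finally have "(real N - \<nu>) / real N \<le> (\<bar>K\<bar> + 1) * D N / \<alpha> N"
          using \<alpha>pos by (simp add: field_simps)
        also have "D N / \<alpha> N = sqrt (D N / real N)"
        proof -
          have "D N = sqrt (D N) * sqrt (D N)" using Dpos[of N] by simp
          then show ?thesis using Dpos[of N] elim by (simp add: \<alpha>_eq real_sqrt_mult real_sqrt_divide field_simps)
        qed
        then have "(\<bar>K\<bar> + 1) * D N / \<alpha> N = (\<bar>K\<bar> + 1) * sqrt (D N / real N)" by (metis times_divide_eq_right)
        finally show ?case using elim by (simp add: \<nu>_def[symmetric] diff_divide_distrib)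
      qed
    qed
    show ?case using sector annulus by (simp add: P_def)
  qed
  have meas_annulus: "(\<lambda>w. real (zeros_annulus (rand_poly a N w) \<rho>) / real N) \<in> borel_measurable M" for N \<rho>
  proof -
    have "closed {z :: complex. 1 - \<rho> \<le> norm z \<and> (\<rho> = 1 \<or> norm z \<le> 1 / (1 - \<rho>))}"
      by (intro closed_Collect_conj closed_Collect_disj closed_Collect_le continuous_intros) auto
    from borel_measurable_root_count[OF _ borel_closed[OF this], of "rand_poly a N" M]
    show ?thesis by (simp add: co zeros_annulus_def)
  qed
  have meas_sector: "(\<lambda>w. real (zeros_sector (rand_poly a N w) \<theta> \<phi>) / real N) \<in> borel_measurable M" for N \<theta> \<phi>
  proof -
    have [measurable]: "Arg2pi \<in> borel_measurable borel" by (rule borel_measurable_Arg2pi)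
    have "{z. \<theta> \<le> Arg2pi z \<and> Arg2pi z < \<phi>} \<in> sets borel" by measurable
    from borel_measurable_root_count[OF _ this, of "rand_poly a N" M]
    show ?thesis by (simp add: co zeros_sector_def)
  qed
  have unit: "0 \<le> real n / real N \<and> real n / real N \<le> 1" if "n \<le> degree (rand_poly a N w)" for n N w
  proof -
    have "n \<le> N" using that deg_le order_trans by blast
    then show ?thesis by (auto simp: divide_le_eq_1)
  qed
  show ?thesis
  proof (intro exI[of _ \<alpha>] conjI allI impI)
    show "AE w in M. (\<lambda>N. real (zeros_annulus (rand_poly a N w) (\<alpha> N / real N)) / real N) \<longlonglongrightarrow> 1"
      using AE_lim by eventually_elim blast
    show "AE w in M. (\<lambda>N. real (zeros_sector (rand_poly a N w) \<theta> \<phi>) / real N) \<longlonglongrightarrow> (\<phi> - \<theta>) / (2 * pi)"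
      if "0 \<le> \<theta> \<and> \<theta> < \<phi> \<and> \<phi> \<le> 2 * pi" for \<theta> \<phi>
      using AE_lim by eventually_elim (use that in blast)
    show "converges_in_mean M p (\<lambda>N w. real (zeros_annulus (rand_poly a N w) (\<alpha> N / real N)) / real N) (\<lambda>w. 1)"
      if "p > 0" for p
      by (rule converges_in_mean_if_bounded[OF meas_annulus unit[OF zeros_annulus_le_degree] _ _ _ that])
        (use AE_lim in \<open>auto elim: eventually_mono\<close>)
    show "converges_in_mean M p (\<lambda>N w. real (zeros_sector (rand_poly a N w) \<theta> \<phi>) / real N) (\<lambda>w. (\<phi> - \<theta>) / (2 * pi))"
      if "p > 0" and \<theta>\<phi>: "0 \<le> \<theta> \<and> \<theta> < \<phi> \<and> \<phi> \<le> 2 * pi" for p \<theta> \<phi>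
    proof (rule converges_in_mean_if_bounded[OF meas_sector unit[OF zeros_sector_le_degree] _ _ _ that(1)])
      show "AE w in M. (\<lambda>N. real (zeros_sector (rand_poly a N w) \<theta> \<phi>) / real N) \<longlonglongrightarrow> (\<phi> - \<theta>) / (2 * pi)"
        using AE_lim by eventually_elim (use \<theta>\<phi> in blast)
    qed (use \<theta>\<phi> in auto)
  qed (use \<alpha> \<alpha>_small in auto)
qed

end
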